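(* Let $G=(V,w,m)$ be a measured weighted graph with $\mathrm{Deg}_{\max}<\infty$ satisfying $CD(\rho,n)$ for some $\rho\colon V\to\mathbb{R}$ and $n\in(0,\infty]$. Then for all bounded $f\colon V\to\mathbb{R}$ and all $t>0$ the following pointwise inequalities on $V$ hold: (i) $\Gamma P_tf\le P_t^{2\rho}\,\Gamma f$; (ii) $2t\,\Gamma P_tf\le P_t^{-2\rho_-}f^2-(P_tf)^2$; (iii) if $K\in\mathbb{R}\setminus\{0\}$ is such that $\rho\le K$ on $V$, then $$\frac{1}{2K}\left(e^{2Kt}-1\right)\Gamma P_tf\le e^{2Kt}P_t^{2\rho}f^2-(P_tf)^2.$$
   Context: A measured weighted graph (mwg) $G=(V,w,m)$ consists of a countable set $V$, a symmetric function $w\colon V\times V\to[0,\infty)$ vanishing on the diagonal, and a function $m\colon V\to(0,\infty)$. All mwg are assumed locally finite (for each $x\in V$ the set $\{y: w(x,y)>0\}$ is finite) and connected. Write $q(x,y)=w(x,y)/m(x)$, $\mathrm{Deg}(x)=\sum_{y}q(x,y)$, $\mathrm{Deg}_{\max}=\sup_x\mathrm{Deg}(x)$. $L^2(V)$ carries the inner product $\langle f,g\rangle=\sum_{x}m(x)f(x)g(x)$. For $f\colon V\to\mathbb{R}$ the Laplacian is $\Delta f(x)=\sum_{y}q(x,y)(f(y)-f(x))$, and $L=-\Delta\ge0$ is the associated nonnegative self-adjoint operator on $L^2(V)$ (bounded when $\mathrm{Deg}_{\max}<\infty$). $P_t=e^{-tL}$ is the heat semigroup, and for $W\colon V\to\mathbb{R}$,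 $P_t^W:=e^{-t(L+W)}$. For $W$ bounded below this is the positivity preserving semigroup of the lower semibounded form sum $L+W$, extended to nonnegative functions $f$ by monotone approximation $P_t^Wf=\sup\{P_t^Wg: 0\le g\le f,\ g\text{ finitely supported}\}$ and then linearly to bounded functions; for $W$ not bounded below, $P_t^Wf:=\lim_{j\to\infty}P_t^{\max(W,-j)}f$ for $f\ge0$ (possibly with value $+\infty$). For bounded $f,g\colon V\to\mathbb{R}$: $\Gamma(f,g)=\frac12(\Delta(fg)-f\Delta g-g\Delta f)$ and $\Gamma_2(f,g)=\frac12(\Delta\Gamma(f,g)-\Gamma(f,\Delta g)-\Gamma(g,\Delta f))$; $\Gamma f:=\Gamma(f,f)$, $\Gamma_2f:=\Gamma_2(f,f)$. $G$ satisfies $CD(\rho,n)$ if for all bounded $f\colon V\to\mathbb{R}$ and all $x\in V$: $\Gamma_2f(x)\ge\rho(x)\Gamma f(x)+\frac1n(\Delta f(x))^2$ (with $\frac1\infty=0$). For $a\in\mathbb{R}$, $a_-:=-\min\{0,a\}$; $\rho_-$ is taken pointwise. *)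

theory Defs
  imports "HOL-Analysis.Analysis" "HOL-Library.Extended_Real"
begin

text \<open>The vertex set is the universe of a countable type.\<close>

definition mwg :: "('v::countable \<Rightarrow> 'v \<Rightarrow> real) \<Rightarrow> ('v \<Rightarrow> real) \<Rightarrow> bool" where
  "mwg w m \<longleftrightarrow>
     (\<forall>x y. 0 \<le> w x y) \<and> (\<forall>x y. w x y = w y x) \<and> (\<forall>x. w x x = 0) \<and>
     (\<forall>x. 0 < m x) \<and>
     (\<forall>x. finite {y. 0 < w x y}) \<and>
     (\<forall>x y. (x, y) \<in> {(a, b). 0 < w a b}\<^sup>*)"

definition qrate :: "('v \<Rightarrow> 'v \<Rightarrow> real) \<Rightarrow> ('v \<Rightarrow> real) \<Rightarrow> 'v \<Rightarrow> 'v \<Rightarrow> real" where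
  "qrate w m x y = w x y / m x"

definition Deg :: "('v \<Rightarrow> 'v \<Rightarrow> real) \<Rightarrow> ('v \<Rightarrow> real) \<Rightarrow> 'v \<Rightarrow> real" where
  "Deg w m x = (\<Sum>y | 0 < w x y. qrate w m x y)"

definition Lap :: "('v \<Rightarrow> 'v \<Rightarrow> real) \<Rightarrow> ('v \<Rightarrow> real) \<Rightarrow> ('v \<Rightarrow> real) \<Rightarrow> 'v \<Rightarrow> real" where
  "Lap w m f x = (\<Sum>y | 0 < w x y. qrate w m x y * (f y - f x))"

definition Gam :: "('v \<Rightarrow> 'v \<Rightarrow> real) \<Rightarrow> ('v \<Rightarrow> real) \<Rightarrow> ('v \<Rightarrow> real) \<Rightarrow> ('v \<Rightarrow> real) \<Rightarrow> 'v \<Rightarrow> real" where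
  "Gam w m f g x =
     (Lap w m (\<lambda>y. f y * g y) x - f x * Lap w m g x - g x * Lap w m f x) / 2"

definition Gam2 :: "('v \<Rightarrow> 'v \<Rightarrow> real) \<Rightarrow> ('v \<Rightarrow> real) \<Rightarrow> ('v \<Rightarrow> real) \<Rightarrow> ('v \<Rightarrow> real) \<Rightarrow> 'v \<Rightarrow> real" where
  "Gam2 w m f g x =
     (Lap w m (Gam w m f g) x - Gam w m f (Lap w m g) x - Gam w m g (Lap w m f) x) / 2"

text \<open>In \<^typ>\<open>ereal\<close>, \<open>1 / \<infinity> = 0\<close>.\<close>

definition CD :: "('v \<Rightarrow> 'v \<Rightarrow> real) \<Rightarrow> ('v \<Rightarrow> real) \<Rightarrow> ('v \<Rightarrow> real) \<Rightarrow> ereal \<Rightarrow> bool" where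
  "CD w m \<rho> n \<longleftrightarrow>
     (\<forall>f. bounded (range f) \<longrightarrow>
        (\<forall>x. Gam2 w m f f x \<ge> \<rho> x * Gam w m f f x + real_of_ereal (1 / n) * (Lap w m f x)\<^sup>2))"

definition L2 :: "('v \<Rightarrow> real) \<Rightarrow> ('v \<Rightarrow> real) set" where
  "L2 m = {f. (\<lambda>x. m x * (f x)\<^sup>2) summable_on UNIV}"

definition L2_inner :: "('v \<Rightarrow> real) \<Rightarrow> ('v \<Rightarrow> real) \<Rightarrow> ('v \<Rightarrow> real) \<Rightarrow> real" where
  "L2_inner m f g = (\<Sum>\<^sub>\<infinity>x. m x * f x * g x)"

definition L2_norm :: "('v \<Rightarrow> real) \<Rightarrow> ('v \<Rightarrow> real) \<Rightarrow> real" where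
  "L2_norm m f = sqrt (L2_inner m f f)"

text \<open>The form sum \<open>L + W\<close>, for \<open>W\<close> bounded below. Here \<open>L\<close> is taken to be
  \<open>- Lap\<close> on all of \<open>L2\<close>, which is appropriate when \<open>Deg\<close> is bounded: then \<open>L\<close> is
  bounded and self-adjoint. Its form domain is then \<open>L2\<close>, and the domain
  of the form sum consists of the \<open>f\<close> in \<open>L2\<close> for which \<open>m |W| f\<^sup>2\<close> is summable. The
  self-adjoint operator of the form is given by its graph: \<open>form_sum_op w m W f h\<close> says that
  \<open>f\<close> lies in the operator domain and that \<open>(L + W) f = h\<close>.\<close>

definition form_dom :: "('v \<Rightarrow> real) \<Rightarrow> ('v \<Rightarrow> real) \<Rightarrow> ('v \<Rightarrow> real) set" where
  "form_dom m W = {f \<in> L2 m. (\<lambda>x. m x * \<bar>W x\<bar> * (f x)\<^sup>2) summable_on UNIV}"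

definition form_sum ::
  "('v \<Rightarrow> 'v \<Rightarrow> real) \<Rightarrow> ('v \<Rightarrow> real) \<Rightarrow> ('v \<Rightarrow> real) \<Rightarrow> ('v \<Rightarrow> real) \<Rightarrow> ('v \<Rightarrow> real) \<Rightarrow> real" where
  "form_sum w m W f g =
     L2_inner m (\<lambda>x. - Lap w m f x) g + (\<Sum>\<^sub>\<infinity>x. m x * W x * f x * g x)"

definition form_sum_op ::
  "('v \<Rightarrow> 'v \<Rightarrow> real) \<Rightarrow> ('v \<Rightarrow> real) \<Rightarrow> ('v \<Rightarrow> real) \<Rightarrow> ('v \<Rightarrow> real) \<Rightarrow> ('v \<Rightarrow> real) \<Rightarrow> bool" where
  "form_sum_op w m W f h \<longleftrightarrow>
     f \<in> form_dom m W \<and> h \<in> L2 m \<and> (\<forall>g\<in>form_dom m W. form_sum w m W f g = L2_inner m h g)"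

definition C0_semigroup ::
  "('v \<Rightarrow> real) \<Rightarrow> (real \<Rightarrow> ('v \<Rightarrow> real) \<Rightarrow> 'v \<Rightarrow> real) \<Rightarrow> bool" where
  "C0_semigroup m T \<longleftrightarrow>
     (\<forall>t\<ge>0. \<forall>f\<in>L2 m. T t f \<in> L2 m) \<and>
     (\<forall>t\<ge>0. \<forall>f\<in>L2 m. \<forall>g\<in>L2 m. \<forall>a b.
        T t (\<lambda>x. a * f x + b * g x) = (\<lambda>x. a * T t f x + b * T t g x)) \<and>
     (\<forall>t\<ge>0. \<exists>C. \<forall>f\<in>L2 m. L2_norm m (T t f) \<le> C * L2_norm m f) \<and>
     (\<forall>f\<in>L2 m. T 0 f = f) \<and>
     (\<forall>s\<ge>0. \<forall>t\<ge>0. \<forall>f\<in>L2 m. T (s + t) f = T s (T t f)) \<and>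
     (\<forall>f\<in>L2 m. ((\<lambda>t. L2_norm m (\<lambda>x. T t f x - f x)) \<longlongrightarrow> 0) (at_right 0))"

text \<open>The graph of the infinitesimal generator of \<open>T\<close>.\<close>

definition generator ::
  "('v \<Rightarrow> real) \<Rightarrow> (real \<Rightarrow> ('v \<Rightarrow> real) \<Rightarrow> 'v \<Rightarrow> real) \<Rightarrow> ('v \<Rightarrow> real) \<Rightarrow> ('v \<Rightarrow> real) \<Rightarrow> bool" where
  "generator m T f h \<longleftrightarrow>
     f \<in> L2 m \<and> h \<in> L2 m \<and>
     ((\<lambda>t. L2_norm m (\<lambda>x. (T t f x - f x) / t - h x)) \<longlongrightarrow> 0) (at_right 0)"

text \<open>\<open>e\<^bsup>-t(L+W)\<^esup>\<close> on \<open>L2\<close>: the strongly continuous semigroup with generator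
  \<open>-(L+W)\<close>. It is determined uniquely only for \<open>t \<ge> 0\<close> and arguments in \<open>L2\<close>, and it is used
  only there.\<close>

definition L2_semigroup ::
  "('v \<Rightarrow> 'v \<Rightarrow> real) \<Rightarrow> ('v \<Rightarrow> real) \<Rightarrow> ('v \<Rightarrow> real) \<Rightarrow> real \<Rightarrow> ('v \<Rightarrow> real) \<Rightarrow> 'v \<Rightarrow> real" where
  "L2_semigroup w m W =
     (SOME T. C0_semigroup m T \<and>
        (\<forall>f h. generator m T f (\<lambda>x. - h x) \<longleftrightarrow> form_sum_op w m W f h))"

text \<open>Extension to nonnegative \<open>f\<close> by monotone approximation, for \<open>W\<close> bounded below.\<close>

definition semigroup_mono ::
  "('v \<Rightarrow> 'v \<Rightarrow> real) \<Rightarrow> ('v \<Rightarrow> real) \<Rightarrow> ('v \<Rightarrow> real) \<Rightarrow> real \<Rightarrow> ('v \<Rightarrow> real) \<Rightarrow> 'v \<Rightarrow> ereal" where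
  "semigroup_mono w m W t f x =
     (SUP g \<in> {g. finite {y. g y \<noteq> 0} \<and> (\<forall>y. 0 \<le> g y \<and> g y \<le> f y)}.
        ereal (L2_semigroup w m W t g x))"

text \<open>\<open>P\<^sub>t\<^sup>W f\<close> for nonnegative \<open>f\<close> and arbitrary \<open>W\<close>.\<close>

definition semigroup_pot ::
  "('v \<Rightarrow> 'v \<Rightarrow> real) \<Rightarrow> ('v \<Rightarrow> real) \<Rightarrow> ('v \<Rightarrow> real) \<Rightarrow> real \<Rightarrow> ('v \<Rightarrow> real) \<Rightarrow> 'v \<Rightarrow> ereal" where
  "semigroup_pot w m W t f x =
     (if bdd_below (range W) then semigroup_mono w m W t f x
      else lim (\<lambda>j::nat. semigroup_mono w m (\<lambda>y. max (W y) (- real j)) t f x))"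

text \<open>\<open>P\<^sub>t f\<close> for bounded real \<open>f\<close>, by linear extension from the positive and negative parts.
  Since \<open>P\<^sub>t\<close> is sub-Markovian, both terms are finite for bounded \<open>f\<close>, so that
  \<^const>\<open>real_of_ereal\<close> loses nothing.\<close>

definition heat ::
  "('v \<Rightarrow> 'v \<Rightarrow> real) \<Rightarrow> ('v \<Rightarrow> real) \<Rightarrow> real \<Rightarrow> ('v \<Rightarrow> real) \<Rightarrow> 'v \<Rightarrow> real" where
  "heat w m t f x =
     real_of_ereal (semigroup_pot w m (\<lambda>_. 0) t (\<lambda>y. max (f y) 0) x)
     - real_of_ereal (semigroup_pot w m (\<lambda>_. 0) t (\<lambda>y. max (- f y) 0) x)"

definition neg_part :: "real \<Rightarrow> real" where
  "neg_part a = - min 0 a"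

end

theory Submission
  imports Defs
begin

text \<open>
  Write \<open>D\<close> for an upper bound of the degrees. As \<open>D\<close> is finite, \<open>\<Delta>\<close> is bounded both on \<open>L2\<close> and on
  the bounded functions, and the curvature condition leaves only bounded potentials to be considered.
  Indeed, testing it with the indicator of a vertex bounds \<open>\<rho>\<close> from above (\<open>curvature_bounded_above\<close>),
  and \<open>\<Gamma>\<^sub>2 f \<ge> - D \<Gamma> f\<close> holds on every graph (\<open>Gam2_ge\<close>), so that \<open>\<rho>\<close> may be replaced by
  \<open>max \<rho> (- c)\<close> with \<open>c \<ge> D\<close>; this raises the potential and therefore lowers the semigroup on the
  right-hand side (\<open>exp_le_semigroup_pot\<close>).

  For bounded \<open>W\<close> the semigroup is the exponential series of \<open>\<Delta> - W\<close>. It preserves positivity, since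
  \<open>\<Delta> - W + b\<close> has a nonnegative kernel for large \<open>b\<close>. Hence subsolutions are dominated
  (\<open>subsolution_le_exp\<close>): if \<open>u' \<le> (\<Delta> - W) u\<close>, then \<open>s \<mapsto> e\<^bsup>s(\<Delta>-W)\<^esup> u\<^bsub>t-s\<^esub>\<close> is nondecreasing, and
  comparing \<open>s = 0\<close> with \<open>s = t\<close> gives \<open>u\<^sub>t \<le> e\<^bsup>t(\<Delta>-W)\<^esup> u\<^sub>0\<close>. All three inequalities are instances:

  \<^item> (i) For \<open>u\<^sub>r = \<Gamma> P\<^sub>r f\<close> and \<open>W = 2 \<rho>\<close>, the difference \<open>(\<Delta> - 2 \<rho>) u - u'\<close> is
    \<open>2 \<Gamma>\<^sub>2 P\<^sub>r f - 2 \<rho> \<Gamma> P\<^sub>r f\<close>.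
  \<^item> (ii), (iii) For \<open>u\<^sub>r = (P\<^sub>r f)\<^sup>2 + 2 E(r) \<Gamma> P\<^sub>r f\<close> and \<open>W = 2 \<rho> - 2 K\<close>, with \<open>\<rho> \<le> K\<close>, \<open>E(0) = 0\<close> and
    \<open>E' = 1 + 2 K E\<close>, the difference is \<open>4 E (\<Gamma>\<^sub>2 - \<rho> \<Gamma>) P\<^sub>r f + 2 (K - \<rho>) (P\<^sub>r f)\<^sup>2\<close>. The choice
    \<open>E(r) = (e\<^bsup>2Kr\<^esup> - 1) / (2 K)\<close> gives (iii), even with an additional factor \<open>2\<close> on the left; the
    choice \<open>K = 0\<close>, \<open>E(r) = r\<close> with \<open>- \<rho>\<^sub>-\<close> in place of \<open>\<rho>\<close> gives (ii).

  The semigroup on \<open>L2\<close> is specified only through its generator, so it has to be identified with the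
  exponential series (\<open>L2_semigroup_eq\<close>). The series has the required generator. Conversely, let \<open>T\<close> be
  any strongly continuous semigroup whose generator is a bounded operator \<open>A\<close> on all of \<open>L2\<close>. By
  uniform boundedness the difference quotients \<open>(T\<^sub>h - I) / h\<close> are bounded in norm for small \<open>h\<close>; hence
  \<open>T\<close> is Lipschitz in time, its orbits are two-sided differentiable, and Taylor's formula yields the
  series (\<open>C0_semigroup_eq_op_exp\<close>). Monotone approximation then extends the identity to bounded
  nonnegative functions (\<open>semigroup_mono_eq\<close>).
\<close>

section \<open>Exponential series of locally finite operators\<close>

text \<open>Operators with finitely supported kernel rows act on arbitrary functions and commute with pointwise
  limits, sums and derivatives. This makes the same exponential series available on \<open>L2\<close> and on the
  bounded functions, neither of which contains the other in general.\<close>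

definition locally_finite_op :: "(('v \<Rightarrow> real) \<Rightarrow> 'v \<Rightarrow> real) \<Rightarrow> bool" where
  "locally_finite_op A \<longleftrightarrow> (\<forall>x. \<exists>M b. finite M \<and> (\<forall>f. A f x = (\<Sum>y\<in>M. b y * f y)))"

lemma locally_finite_opE:
  assumes "locally_finite_op A"
  obtains M b where "finite M" "\<And>f. A f x = (\<Sum>y\<in>M. b y * f y)"
  using assms unfolding locally_finite_op_def by blast

lemma locally_finite_op_id: "locally_finite_op (\<lambda>f. f)"
  unfolding locally_finite_op_def
proof
  fix x :: 'a
  show "\<exists>M b. finite M \<and> (\<forall>f. f x = (\<Sum>y\<in>M. b y * f y :: real))"
    by (rule exI[of _ "{x}"], rule exI[of _ "\<lambda>_. 1"]) auto
qed

lemma locally_finite_op_compose: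
  assumes "locally_finite_op A" "locally_finite_op B"
  shows "locally_finite_op (\<lambda>f. A (B f))"
  unfolding locally_finite_op_def
proof
  fix x :: 'a
  obtain M b where M: "finite M" "\<And>f. A f x = (\<Sum>y\<in>M. b y * f y)"
    using assms(1) by (rule locally_finite_opE[where x = x]) blast
  have "\<forall>y. \<exists>N c. finite N \<and> (\<forall>f. B f y = (\<Sum>z\<in>N. c z * f z))"
    using assms(2) unfolding locally_finite_op_def .
  then obtain N c where N: "\<And>y. finite (N y)" "\<And>f y. B f y = (\<Sum>z\<in>N y. c y z * f z)"
    by metis
  define U where "U = (\<Union>y\<in>M. N y)"
  define d where "d z = (\<Sum>y\<in>M. b y * (if z \<in> N y then c y z else 0))" for z
  have fin: "finite U" unfolding U_def using M N by auto
  have "A (B f) x = (\<Sum>z\<in>U. d z * f z)" for f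
  proof -
    have "A (B f) x = (\<Sum>y\<in>M. b y * (\<Sum>z\<in>U. (if z \<in> N y then c y z else 0) * f z))"
      unfolding M(2) N(2)
    proof (rule sum.cong[OF refl])
      fix y assume y: "y \<in> M"
      have "(\<Sum>z\<in>N y. c y z * f z) = (\<Sum>z\<in>U. (if z \<in> N y then c y z else 0) * f z)"
        by (rule sum.mono_neutral_cong_left) (use fin y in \<open>auto simp: U_def\<close>)
      then show "b y * (\<Sum>z\<in>N y. c y z * f z)
          = b y * (\<Sum>z\<in>U. (if z \<in> N y then c y z else 0) * f z)" by simp
    qed
    also have "\<dots> = (\<Sum>z\<in>U. d z * f z)"
      unfolding d_def sum_distrib_left sum_distrib_right
      by (subst sum.swap) (simp add: mult.assoc)
    finally show ?thesis .
  qed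
  with fin show "\<exists>M b. finite M \<and> (\<forall>f. A (B f) x = (\<Sum>y\<in>M. b y * f y))" by blast
qed

lemma locally_finite_op_power: "locally_finite_op A \<Longrightarrow> locally_finite_op (A ^^ k)"
proof (induction k)
  case 0
  then show ?case using locally_finite_op_id by (simp add: id_def)
next
  case (Suc k)
  then show ?case using locally_finite_op_compose[of A "A ^^ k"] by (simp add: comp_def)
qed

lemma locally_finite_op_lincomb:
  assumes "locally_finite_op A"
  shows "A (\<lambda>y. a * f y + b * g y) x = a * A f x + b * A g x"
  by (rule locally_finite_opE[OF assms, of x])
     (simp add: sum_distrib_left sum.distrib algebra_simps)

lemma locally_finite_op_scale: "locally_finite_op A \<Longrightarrow> A (\<lambda>y. a * f y) x = a * A f x"
  using locally_finite_op_lincomb[of A a f 0 f x] by simp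

lemma locally_finite_op_suminf:
  assumes "locally_finite_op A" "\<And>y. summable (\<lambda>k. F k y)"
  shows "A (\<lambda>y. \<Sum>k. F k y) x = (\<Sum>k. A (F k) x)"
proof -
  obtain M b where M: "finite M" "\<And>f. A f x = (\<Sum>y\<in>M. b y * f y)"
    using assms(1) by (rule locally_finite_opE[where x = x]) blast
  show ?thesis unfolding M(2)
    by (subst suminf_sum) (auto intro!: sum.cong summable_mult suminf_mult[symmetric] assms(2))
qed

lemma locally_finite_op_tendsto:
  assumes "locally_finite_op A" "\<And>y. ((\<lambda>i. F i y) \<longlongrightarrow> f y) G"
  shows "((\<lambda>i. A (F i) x) \<longlongrightarrow> A f x) G"
proof -
  obtain M b where M: "finite M" "\<And>f. A f x = (\<Sum>y\<in>M. b y * f y)"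
    using assms(1) by (rule locally_finite_opE[where x = x]) blast
  show ?thesis unfolding M(2) by (intro tendsto_sum tendsto_mult tendsto_const assms(2))
qed

lemma locally_finite_op_DERIV:
  assumes "locally_finite_op A" "\<And>y. ((\<lambda>s. h s y) has_real_derivative h' y) (at s)"
  shows "((\<lambda>s. A (h s) x) has_real_derivative A h' x) (at s)"
proof -
  obtain M b where M: "finite M" "\<And>f. A f x = (\<Sum>y\<in>M. b y * f y)"
    using assms(1) by (rule locally_finite_opE[where x = x]) blast
  show ?thesis unfolding M(2) by (intro DERIV_sum DERIV_cmult assms(2))
qed

definition op_exp :: "(('v \<Rightarrow> real) \<Rightarrow> 'v \<Rightarrow> real) \<Rightarrow> real \<Rightarrow> ('v \<Rightarrow> real) \<Rightarrow> 'v \<Rightarrow> real" where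
  "op_exp A t f x = (\<Sum>k. t ^ k / fact k * (A ^^ k) f x)"

lemma summable_exp_real: "summable (\<lambda>k. (t::real) ^ k / fact k * (H * c ^ k))"
proof -
  have "summable (\<lambda>k. H * (inverse (fact k) * (t * c) ^ k))"
    by (intro summable_mult summable_exp)
  then show ?thesis by (simp add: power_mult_distrib field_simps)
qed

lemma suminf_exp_real: "(\<Sum>k. (t::real) ^ k / fact k * (H * c ^ k)) = exp (t * c) * H"
proof -
  have "(\<Sum>k. t ^ k / fact k * (H * c ^ k)) = (\<Sum>k. H * ((t * c) ^ k /\<^sub>R fact k))"
    by (simp add: power_mult_distrib field_simps)
  also have "\<dots> = H * (\<Sum>k. (t * c) ^ k /\<^sub>R fact k)"
    using summable_exp[of "t * c"] by (intro suminf_mult) (simp add: field_simps)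
  finally show ?thesis by (simp add: exp_def)
qed

lemma op_exp_summable:
  fixes A :: "('v \<Rightarrow> real) \<Rightarrow> 'v \<Rightarrow> real"
  assumes "\<And>k. \<bar>(A ^^ k) f x\<bar> \<le> H * c ^ k"
  shows "summable (\<lambda>k. t ^ k / fact k * (A ^^ k) f x)"
proof (rule summable_comparison_test'[OF summable_exp_real[of "\<bar>t\<bar>" H c], of 0])
  fix k :: nat
  show "norm (t ^ k / fact k * (A ^^ k) f x) \<le> \<bar>t\<bar> ^ k / fact k * (H * c ^ k)"
    using mult_left_mono[OF assms[of k], of "\<bar>t\<bar> ^ k / fact k"]
    by (simp add: abs_mult power_abs)
qed

lemma op_exp_0 [simp]: "op_exp A 0 f = f"
proof
  fix x
  show "op_exp A 0 f x = f x"
    unfolding op_exp_def by (subst suminf_finite[of "{0}"]) (auto simp: power_0_left)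
qed

text \<open>The series is differentiated term by term; the exponential bounds on the powers at the single point
  \<open>x\<close> give the uniform majorant.\<close>

lemma op_exp_DERIV:
  assumes A: "locally_finite_op A" and s0: "\<bar>s0\<bar> < R"
    and h: "\<And>s y. ((\<lambda>r. h r y) has_real_derivative h' s y) (at s)"
    and bd: "\<And>k s. \<bar>s\<bar> \<le> R \<Longrightarrow> \<bar>(A ^^ k) (h s) x\<bar> \<le> H * c ^ k"
    and bd': "\<And>k s. \<bar>s\<bar> \<le> R \<Longrightarrow> \<bar>(A ^^ k) (h' s) x\<bar> \<le> H * c ^ k"
  shows "((\<lambda>s. op_exp A s (h s) x) has_real_derivative
           op_exp A s0 (\<lambda>y. A (h s0) y + h' s0 y) x) (at s0)"
proof -
  define S where "S = {-R..R}"
  define F where "F k s = s ^ k / fact k * (A ^^ k) (h s) x" for k s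
  define F' where "F' k s = (real k * s ^ (k - 1)) / fact k * (A ^^ k) (h s) x
      + s ^ k / fact k * (A ^^ k) (h' s) x" for k s
  have R: "0 < R" using s0 by linarith
  have deriv: "(F k has_field_derivative F' k s) (at s within S)" for k s
  proof -
    have "((\<lambda>s. (A ^^ k) (h s) x) has_real_derivative (A ^^ k) (h' s) x) (at s)"
      by (rule locally_finite_op_DERIV[OF locally_finite_op_power[OF A] h])
    then have "(F k has_field_derivative F' k s) (at s)"
      unfolding F_def[abs_def] F'_def
      by (auto intro!: derivative_eq_intros simp: field_simps)
    then show ?thesis by (rule has_field_derivative_at_within)
  qed
  define M where "M k = (real k * R ^ (k - 1)) / fact k * (H * c ^ k) + R ^ k / fact k * (H * c ^ k)" for k
  have "summable (\<lambda>k. (real (Suc k) * R ^ k) / fact (Suc k) * (H * c ^ Suc k))"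
  proof -
    have eq: "(real (Suc k) * R ^ k) / fact (Suc k) * (H * c ^ Suc k) = R ^ k / fact k * ((H * c) * c ^ k)" for k
    proof -
      have "(real (Suc k) * R ^ k) / fact (Suc k) = R ^ k / fact k"
        by (simp add: fact_Suc del: of_nat_Suc)
      then show ?thesis by simp
    qed
    show ?thesis unfolding eq by (rule summable_exp_real)
  qed
  then have "summable (\<lambda>k. (real k * R ^ (k - 1)) / fact k * (H * c ^ k))"
    by (subst summable_Suc_iff[symmetric]) simp
  then have M: "summable M"
    unfolding M_def by (intro summable_add summable_exp_real)
  have FM: "norm (F' k s) \<le> M k" if "s \<in> S" for k s
  proof -
    have s: "\<bar>s\<bar> \<le> R" using that by (auto simp: S_def)
    have "\<bar>(real k * s ^ (k - 1)) / fact k * (A ^^ k) (h s) x\<bar>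
        \<le> (real k * R ^ (k - 1)) / fact k * (H * c ^ k)"
    proof -
      have "\<bar>(real k * s ^ (k - 1)) / fact k\<bar> \<le> (real k * R ^ (k - 1)) / fact k"
        using s by (auto simp: abs_mult power_abs intro!: divide_right_mono mult_left_mono power_mono)
      from mult_mono[OF this bd[OF s, of k]] R show ?thesis by (simp add: abs_mult)
    qed
    moreover have "\<bar>s ^ k / fact k * (A ^^ k) (h' s) x\<bar> \<le> R ^ k / fact k * (H * c ^ k)"
    proof -
      have "\<bar>s ^ k / fact k\<bar> \<le> R ^ k / fact k"
        using s by (auto simp: power_abs intro!: divide_right_mono power_mono)
      from mult_mono[OF this bd'[OF s, of k]] R show ?thesis by (simp add: abs_mult)
    qed
    ultimately show ?thesis
      unfolding F'_def M_def real_norm_def by (rule order_trans[OF abs_triangle_ineq add_mono])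
  qed
  have unif: "uniformly_convergent_on S (\<lambda>k s. \<Sum>i<k. F' i s)"
    by (rule Weierstrass_m_test'[OF FM M])
  have summ: "summable (\<lambda>k. s0 ^ k / fact k * (A ^^ k) (h s0) x)"
    "summable (\<lambda>k. s0 ^ k / fact k * (A ^^ k) (h' s0) x)"
    using op_exp_summable[OF bd[OF less_imp_le[OF s0]]] op_exp_summable[OF bd'[OF less_imp_le[OF s0]]]
    by blast+
  have "((\<lambda>s. \<Sum>k. F k s) has_field_derivative (\<Sum>k. F' k s0)) (at s0)"
  proof (rule has_field_derivative_series'(2)[where S = S and x0 = s0])
    show "convex S" by (simp add: S_def)
    show "s0 \<in> S" "s0 \<in> interior S" using s0 by (auto simp: S_def)
    show "summable (\<lambda>n. F n s0)" unfolding F_def by (rule summ)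
  qed (use deriv unif in auto)
  moreover have "(\<Sum>k. F' k s0) = op_exp A s0 (\<lambda>y. A (h s0) y + h' s0 y) x"
  proof -
    define G where "G k = (real k * s0 ^ (k - 1)) / fact k * (A ^^ k) (h s0) x" for k
    have G0: "G 0 = 0" by (simp add: G_def)
    have eq: "G (Suc k) = s0 ^ k / fact k * (A ^^ k) (A (h s0)) x" for k
    proof -
      have "(real (Suc k) * s0 ^ k) / fact (Suc k) = s0 ^ k / fact k"
        by (simp add: fact_Suc del: of_nat_Suc)
      then show ?thesis unfolding G_def by (simp add: funpow_Suc_right del: funpow.simps)
    qed
    have sG: "summable (\<lambda>k. G (Suc k))"
      unfolding eq
    proof (rule op_exp_summable)
      fix k
      have "\<bar>(A ^^ Suc k) (h s0) x\<bar> \<le> H * c ^ Suc k" using bd s0 by (meson less_imp_le)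
      then show "\<bar>(A ^^ k) (A (h s0)) x\<bar> \<le> (H * c) * c ^ k"
        by (simp add: funpow_Suc_right del: funpow.simps)
    qed
    then have sG': "summable G" by (subst summable_Suc_iff[symmetric])
    have "(\<Sum>k. F' k s0) = (\<Sum>k. G k) + (\<Sum>k. s0 ^ k / fact k * (A ^^ k) (h' s0) x)"
      unfolding F'_def G_def[symmetric] by (rule suminf_add[symmetric, OF sG' summ(2)])
    also have "(\<Sum>k. G k) = (\<Sum>k. G (Suc k))"
      using suminf_split_head[OF sG'] G0 by simp
    also have "\<dots> + (\<Sum>k. s0 ^ k / fact k * (A ^^ k) (h' s0) x)
        = (\<Sum>k. G (Suc k) + s0 ^ k / fact k * (A ^^ k) (h' s0) x)"
      by (rule suminf_add[OF sG summ(2)])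
    also have "\<dots> = op_exp A s0 (\<lambda>y. A (h s0) y + h' s0 y) x"
      unfolding op_exp_def eq
      using locally_finite_op_lincomb[OF locally_finite_op_power[OF A], where a = 1 and b = 1]
      by (simp add: ring_distribs)
    finally show ?thesis .
  qed
  ultimately show ?thesis unfolding F_def op_exp_def by simp
qed

text \<open>\<open>Q f C\<close> reads ``the norm of \<open>f\<close> is at most \<open>C\<close>'', with \<open>Q f C\<close> impossible for every \<open>C\<close> if \<open>f\<close> lies
  outside the space. Point evaluations are bounded, with norm at most \<open>\<kappa> x\<close>, and closure
  under pointwise limits takes the role of completeness.\<close>

locale gauge =
  fixes Q :: "('v \<Rightarrow> real) \<Rightarrow> real \<Rightarrow> bool" and \<kappa> :: "'v \<Rightarrow> real"
  assumes Q_nonneg: "Q f C \<Longrightarrow> 0 \<le> C"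
    and Q_point: "Q f C \<Longrightarrow> \<bar>f x\<bar> \<le> \<kappa> x * C"
    and Q_mono: "Q f C \<Longrightarrow> C \<le> D \<Longrightarrow> Q f D"
    and Q_add: "Q f C \<Longrightarrow> Q g D \<Longrightarrow> Q (\<lambda>x. f x + g x) (C + D)"
    and Q_scale: "Q f C \<Longrightarrow> Q (\<lambda>x. a * f x) (\<bar>a\<bar> * C)"
    and Q_lim: "(\<And>k::nat. Q (F k) C) \<Longrightarrow> (\<And>x. (\<lambda>k. F k x) \<longlonglongrightarrow> f x) \<Longrightarrow> Q f C"
begin

lemma Q_suminf:
  assumes F: "\<And>k. Q (F k) (C k)" and C: "summable C"
  shows "summable (\<lambda>k. F k x)" and "Q (\<lambda>x. \<Sum>k. F k x) (suminf C)"
proof -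
  show summ: "summable (\<lambda>k. F k x)" for x
    by (rule summable_comparison_test'[OF summable_mult[OF C, of "\<kappa> x"], of 0])
       (use Q_point[OF F] in auto)
  have part: "Q (\<lambda>x. \<Sum>k<n. F k x) (\<Sum>k<n. C k)" for n
  proof (induction n)
    case 0
    then show ?case using Q_scale[OF F[of 0], of 0] by simp
  next
    case (Suc n)
    then show ?case using Q_add[OF Suc F[of n]] by (simp add: add.commute)
  qed
  have "Q (\<lambda>x. \<Sum>k<n. F k x) (suminf C)" for n
    by (rule Q_mono[OF part sum_le_suminf[OF C]]) (use Q_nonneg[OF F] in auto)
  then show "Q (\<lambda>x. \<Sum>k. F k x) (suminf C)"
    by (rule Q_lim) (rule summable_LIMSEQ[OF summ])
qed

end

locale gauged_operator = gauge +
  fixes A :: "('v \<Rightarrow> real) \<Rightarrow> 'v \<Rightarrow> real" and c :: real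
  assumes A: "locally_finite_op A" and c_nonneg: "0 \<le> c"
    and Q_A: "Q f C \<Longrightarrow> Q (A f) (c * C)"
begin

lemma Q_power: "Q f C \<Longrightarrow> Q ((A ^^ k) f) (C * c ^ k)"
proof (induction k)
  case (Suc k)
  then show ?case using Q_A[of "(A ^^ k) f" "C * c ^ k"] by (simp add: mult_ac)
qed simp

lemma power_bound: "Q f C \<Longrightarrow> \<bar>(A ^^ k) f x\<bar> \<le> \<kappa> x * C * c ^ k"
  using Q_point[OF Q_power] by (simp add: mult.assoc)

lemma Q_term: "Q f C \<Longrightarrow> Q (\<lambda>x. t ^ k / fact k * (A ^^ k) f x) (\<bar>t\<bar> ^ k / fact k * (C * c ^ k))"
  using Q_scale[OF Q_power, of f C "t ^ k / fact k" k] by (simp add: power_abs)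

lemma term_summable: "Q f C \<Longrightarrow> summable (\<lambda>k. t ^ k / fact k * (A ^^ k) f x)"
  by (rule Q_suminf(1)[OF Q_term summable_exp_real])

lemma Q_exp:
  assumes "Q f C" shows "Q (op_exp A t f) (exp (\<bar>t\<bar> * c) * C)"
  using Q_suminf(2)[OF Q_term[OF assms, of t] summable_exp_real]
  by (simp only: suminf_exp_real op_exp_def[abs_def])

lemma exp_lincomb:
  assumes "Q f C" "Q g D"
  shows "op_exp A t (\<lambda>y. a * f y + b * g y) x = a * op_exp A t f x + b * op_exp A t g x"
proof -
  note s = term_summable[OF assms(1), of t x] term_summable[OF assms(2), of t x]
  have "op_exp A t (\<lambda>y. a * f y + b * g y) x
      = (\<Sum>k. a * (t ^ k / fact k * (A ^^ k) f x) + b * (t ^ k / fact k * (A ^^ k) g x))"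
    unfolding op_exp_def locally_finite_op_lincomb[OF locally_finite_op_power[OF A]]
    by (simp add: algebra_simps)
  also have "\<dots> = (\<Sum>k. a * (t ^ k / fact k * (A ^^ k) f x)) + (\<Sum>k. b * (t ^ k / fact k * (A ^^ k) g x))"
    by (intro suminf_add[symmetric] summable_mult s)
  finally show ?thesis unfolding op_exp_def by (simp only: suminf_mult[OF s(1)] suminf_mult[OF s(2)])
qed

lemma exp_scale: "Q f C \<Longrightarrow> op_exp A t (\<lambda>y. a * f y) x = a * op_exp A t f x"
  using exp_lincomb[of f C f C t a 0 x] by simp

lemma exp_commute:
  assumes "Q f C" shows "A (op_exp A t f) x = op_exp A t (A f) x"
proof -
  have "A (op_exp A t f) x = (\<Sum>k. A (\<lambda>y. t ^ k / fact k * (A ^^ k) f y) x)"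
    unfolding op_exp_def[abs_def]
    by (rule locally_finite_op_suminf[OF A]) (rule term_summable[OF assms])
  then show ?thesis
    unfolding locally_finite_op_scale[OF A] op_exp_def
    using funpow_swap1[of A _ f] by simp
qed

lemma exp_path_DERIV:
  assumes s0: "\<bar>s0\<bar> < R"
    and h: "\<And>s y. ((\<lambda>r. h r y) has_real_derivative h' s y) (at s)"
    and bd: "\<And>s. \<bar>s\<bar> \<le> R \<Longrightarrow> Q (h s) H" "\<And>s. \<bar>s\<bar> \<le> R \<Longrightarrow> Q (h' s) H"
  shows "((\<lambda>s. op_exp A s (h s) x) has_real_derivative
           op_exp A s0 (\<lambda>y. A (h s0) y + h' s0 y) x) (at s0)"
  by (rule op_exp_DERIV[OF A s0 h, where H = "\<kappa> x * H" and c = c]) (use power_bound bd in blast)+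

lemma exp_DERIV:
  assumes f: "Q f C"
  shows "((\<lambda>s. op_exp A s f x) has_real_derivative A (op_exp A s f) x) (at s)"
proof -
  have Q0: "Q (\<lambda>_. 0) C" using Q_mono[OF Q_scale[OF f, of 0]] Q_nonneg[OF f] by simp
  have "((\<lambda>s. op_exp A s f x) has_real_derivative op_exp A s (\<lambda>y. A f y + 0) x) (at s)"
    by (rule exp_path_DERIV[where R = "\<bar>s\<bar> + 1" and H = C]) (use f Q0 in auto)
  then show ?thesis using exp_commute[OF f] by simp
qed

lemma Q_exp_le:
  assumes "Q f C" "\<bar>t\<bar> \<le> R"
  shows "Q (op_exp A t f) (exp (R * c) * C)"
proof (rule Q_mono[OF Q_exp[OF assms(1)]])
  show "exp (\<bar>t\<bar> * c) * C \<le> exp (R * c) * C"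
    using Q_nonneg[OF assms(1)] assms(2) c_nonneg by (auto intro!: mult_right_mono)
qed

text \<open>The derivative of \<open>r \<mapsto> e\<^bsup>rA\<^esup> e\<^bsup>(s+t-r)A\<^esup> f\<close> vanishes, so its values at \<open>0\<close> and \<open>s\<close> agree. This replaces a
  Cauchy product of series.\<close>

lemma exp_group:
  assumes f: "Q f C"
  shows "op_exp A s (op_exp A t f) x = op_exp A (s + t) f x"
proof -
  define \<phi> where "\<phi> r = op_exp A r (op_exp A (s + t - r) f) x" for r
  have "(\<phi> has_real_derivative 0) (at r)" for r
  proof -
    define R where "R = \<bar>r\<bar> + 1"
    define H where "H = exp ((\<bar>s + t\<bar> + R) * c) * C"
    define H' where "H' = max H (c * H)"
    have b1: "Q (op_exp A (s + t - v) f) H" if "\<bar>v\<bar> \<le> R" for v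
      unfolding H_def by (rule Q_exp_le[OF f]) (use that in linarith)
    have b2: "Q (op_exp A (s + t - v) f) H'" if "\<bar>v\<bar> \<le> R" for v
      by (rule Q_mono[OF b1[OF that]]) (simp add: H'_def)
    have b3: "Q (\<lambda>y. - A (op_exp A (s + t - v) f) y) H'" if "\<bar>v\<bar> \<le> R" for v
      using Q_mono[OF Q_scale[OF Q_A[OF b1[OF that]], of "-1"], of H'] by (simp add: H'_def)
    have d: "((\<lambda>v. op_exp A (s + t - v) f y) has_real_derivative - A (op_exp A (s + t - v) f) y) (at v)" for v y
    proof -
      have "((\<lambda>v. s + t - v) has_real_derivative -1) (at v)" by (auto intro!: derivative_eq_intros)
      from DERIV_chain2[OF exp_DERIV[OF f] this] show ?thesis by simp
    qed
    have "(\<phi> has_real_derivative op_exp A r (\<lambda>y. A (op_exp A (s + t - r) f) y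
             + - A (op_exp A (s + t - r) f) y) x) (at r)"
      unfolding \<phi>_def[abs_def]
      by (rule exp_path_DERIV[where R = R and H = H' and h = "\<lambda>v. op_exp A (s + t - v) f"
            and h' = "\<lambda>v y. - A (op_exp A (s + t - v) f) y", OF _ d b2 b3])
         (simp_all add: R_def)
    moreover have "op_exp A r (\<lambda>y. 0) x = 0"
      using exp_scale[OF f, of r 0 x] by simp
    ultimately show ?thesis by simp
  qed
  then have "\<phi> s = \<phi> 0" by (intro DERIV_isconst_all) auto
  then show ?thesis by (simp add: \<phi>_def)
qed

lemma Q_exp_remainder:
  assumes f: "Q f C" and t: "\<bar>t\<bar> * c \<le> 1"
  shows "Q (\<lambda>x. op_exp A t f x - f x - t * A f x) ((\<bar>t\<bar> * c)\<^sup>2 * C)"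
proof -
  define F where "F k x = t ^ k / fact k * (A ^^ k) f x" for k x
  define D where "D k = \<bar>t\<bar> ^ k / fact k * (C * c ^ k)" for k
  have D: "summable D" unfolding D_def by (rule summable_exp_real)
  have QF: "Q (F k) (D k)" for k unfolding F_def D_def by (rule Q_term[OF f])
  have rem: "Q (\<lambda>x. \<Sum>k. F (k + 2) x) (\<Sum>k. D (k + 2))"
    by (rule Q_suminf(2)[OF QF summable_ignore_initial_segment[OF D]])
  have 1: "op_exp A t f x - f x - t * A f x = (\<Sum>k. F (k + 2) x)" for x
    using suminf_split_initial_segment[OF Q_suminf(1)[OF QF D, of x], of 2]
    by (simp add: op_exp_def F_def numeral_2_eq_2)
  have D01: "D 0 = C" "D (Suc 0) = \<bar>t\<bar> * c * C" by (simp_all add: D_def)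
  have "(\<Sum>k. D k) = exp (\<bar>t\<bar> * c) * C" unfolding D_def by (rule suminf_exp_real)
  then have "(\<Sum>k. D (k + 2)) = (exp (\<bar>t\<bar> * c) - 1 - \<bar>t\<bar> * c) * C"
    using suminf_split_initial_segment[OF D, of 2] D01
    by (simp add: numeral_2_eq_2 algebra_simps)
  also have "\<dots> \<le> (\<bar>t\<bar> * c)\<^sup>2 * C"
    using exp_bound[of "\<bar>t\<bar> * c"] t c_nonneg Q_nonneg[OF f] by (intro mult_right_mono) auto
  finally show ?thesis unfolding 1 by (rule Q_mono[OF rem])
qed

end

section \<open>The weighted space L2 and uniform boundedness\<close>

definition L2_le :: "('v \<Rightarrow> real) \<Rightarrow> ('v \<Rightarrow> real) \<Rightarrow> real \<Rightarrow> bool" where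
  "L2_le m f C \<longleftrightarrow> (\<forall>X. finite X \<longrightarrow> L2_set (\<lambda>x. sqrt (m x) * f x) X \<le> C)"

locale L2_space =
  fixes m :: "'v \<Rightarrow> real"
  assumes m_pos: "0 < m x"
begin

lemma L2_le_iff: "L2_le m f C \<longleftrightarrow> 0 \<le> C \<and> (\<forall>X. finite X \<longrightarrow> (\<Sum>x\<in>X. m x * (f x)\<^sup>2) \<le> C\<^sup>2)"
proof -
  have eq: "L2_set (\<lambda>x. sqrt (m x) * f x) X = sqrt (\<Sum>x\<in>X. m x * (f x)\<^sup>2)" for X
    using m_pos by (simp add: L2_set_def power_mult_distrib less_imp_le)
  have "0 \<le> C" if "L2_le m f C"
    using that[unfolded L2_le_def, rule_format, of "{}"] by simp
  then show ?thesis
    unfolding L2_le_def eq by (auto intro!: real_le_lsqrt dest: sqrt_le_D)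
qed

sublocale gauge "L2_le m" "\<lambda>x. 1 / sqrt (m x)"
proof
  fix f g :: "'v \<Rightarrow> real" and C D a :: real and x
  show "0 \<le> C" if "L2_le m f C" using that by (simp add: L2_le_iff)
  show "\<bar>f x\<bar> \<le> 1 / sqrt (m x) * C" if "L2_le m f C"
  proof -
    have "L2_set (\<lambda>x. sqrt (m x) * f x) {x} \<le> C" using that unfolding L2_le_def by blast
    then have "sqrt (m x) * \<bar>f x\<bar> \<le> C" using m_pos[of x] by (simp add: abs_mult)
    then show ?thesis using m_pos[of x] by (simp add: field_simps)
  qed
  show "L2_le m f D" if "L2_le m f C" "C \<le> D"
    using that unfolding L2_le_def by (meson order_trans)
  show "L2_le m (\<lambda>x. f x + g x) (C + D)" if "L2_le m f C" "L2_le m g D"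
    unfolding L2_le_def
  proof (intro allI impI)
    fix X :: "'v set" assume X: "finite X"
    have "L2_set (\<lambda>x. sqrt (m x) * f x + sqrt (m x) * g x) X
        \<le> L2_set (\<lambda>x. sqrt (m x) * f x) X + L2_set (\<lambda>x. sqrt (m x) * g x) X"
      by (rule L2_set_triangle_ineq)
    also have "\<dots> \<le> C + D" using that X unfolding L2_le_def by (intro add_mono) auto
    finally show "L2_set (\<lambda>x. sqrt (m x) * (f x + g x)) X \<le> C + D" by (simp add: ring_distribs)
  qed
  show "L2_le m (\<lambda>x. a * f x) (\<bar>a\<bar> * C)" if "L2_le m f C"
    unfolding L2_le_iff
  proof (intro conjI allI impI)
    show "0 \<le> \<bar>a\<bar> * C" using that by (simp add: L2_le_iff)
    fix X :: "'v set" assume "finite X"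
    then have "a\<^sup>2 * (\<Sum>x\<in>X. m x * (f x)\<^sup>2) \<le> a\<^sup>2 * C\<^sup>2"
      using that by (intro mult_left_mono) (auto simp: L2_le_iff)
    then show "(\<Sum>x\<in>X. m x * (a * f x)\<^sup>2) \<le> (\<bar>a\<bar> * C)\<^sup>2"
      by (simp add: sum_distrib_left power_mult_distrib mult_ac)
  qed
next
  fix F :: "nat \<Rightarrow> 'v \<Rightarrow> real" and f C
  assume F: "\<And>k. L2_le m (F k) C" and lim: "\<And>x. (\<lambda>k. F k x) \<longlonglongrightarrow> f x"
  show "L2_le m f C"
    unfolding L2_le_iff
  proof (intro conjI allI impI)
    show "0 \<le> C" using F[of 0] by (simp add: L2_le_iff)
    fix X :: "'v set" assume "finite X"
    have "(\<lambda>k. \<Sum>x\<in>X. m x * (F k x)\<^sup>2) \<longlonglongrightarrow> (\<Sum>x\<in>X. m x * (f x)\<^sup>2)"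
      by (intro tendsto_intros lim)
    then show "(\<Sum>x\<in>X. m x * (f x)\<^sup>2) \<le> C\<^sup>2"
      by (rule Lim_bounded[where M = 0]) (use F \<open>finite X\<close> in \<open>auto simp: L2_le_iff\<close>)
  qed
qed

lemma L2_le_norm:
  assumes "f \<in> L2 m" shows "L2_le m f (L2_norm m f)"
proof -
  have summ: "(\<lambda>x. m x * (f x)\<^sup>2) summable_on UNIV" using assms by (simp add: L2_def)
  have nn: "0 \<le> (\<Sum>\<^sub>\<infinity>x. m x * (f x)\<^sup>2)"
    by (rule infsum_nonneg) (simp add: m_pos less_imp_le)
  have "(\<Sum>x\<in>X. m x * (f x)\<^sup>2) \<le> (\<Sum>\<^sub>\<infinity>x. m x * (f x)\<^sup>2)" if "finite X" for X
    by (rule finite_sum_le_infsum) (use summ that m_pos in \<open>auto simp: less_imp_le\<close>)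
  moreover have "L2_norm m f = sqrt (\<Sum>\<^sub>\<infinity>x. m x * (f x)\<^sup>2)"
    by (simp add: L2_norm_def L2_inner_def power2_eq_square mult.assoc)
  ultimately show ?thesis using nn by (simp add: L2_le_iff)
qed

lemma L2_le_imp:
  assumes "L2_le m f C" shows "f \<in> L2 m" "L2_norm m f \<le> C"
proof -
  have C: "0 \<le> C" "\<And>X. finite X \<Longrightarrow> (\<Sum>x\<in>X. m x * (f x)\<^sup>2) \<le> C\<^sup>2"
    using assms by (auto simp: L2_le_iff)
  have summ: "(\<lambda>x. m x * (f x)\<^sup>2) summable_on UNIV"
    by (rule nonneg_bdd_above_summable_on)
       (use C m_pos in \<open>auto simp: less_imp_le intro!: bdd_aboveI[of _ "C\<^sup>2"]\<close>)
  then show "f \<in> L2 m" by (simp add: L2_def)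
  have "(\<Sum>\<^sub>\<infinity>x. m x * (f x)\<^sup>2) \<le> C\<^sup>2"
    by (rule infsum_le_finite_sums) (use summ C in auto)
  then have "sqrt (\<Sum>\<^sub>\<infinity>x. m x * (f x)\<^sup>2) \<le> C" using C(1) by (simp add: real_le_lsqrt)
  then show "L2_norm m f \<le> C"
    by (simp add: L2_norm_def L2_inner_def power2_eq_square mult.assoc)
qed

lemma L2_norm_nonneg [simp]: "f \<in> L2 m \<Longrightarrow> 0 \<le> L2_norm m f"
  using Q_nonneg[OF L2_le_norm] .

lemma L2_point: "f \<in> L2 m \<Longrightarrow> \<bar>f x\<bar> \<le> 1 / sqrt (m x) * L2_norm m f"
  using Q_point[OF L2_le_norm] .

lemma L2_add:
  assumes "f \<in> L2 m" "g \<in> L2 m"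
  shows "(\<lambda>x. f x + g x) \<in> L2 m" "L2_norm m (\<lambda>x. f x + g x) \<le> L2_norm m f + L2_norm m g"
  using L2_le_imp[OF Q_add[OF L2_le_norm[OF assms(1)] L2_le_norm[OF assms(2)]]] .

lemma L2_scale:
  assumes "f \<in> L2 m"
  shows "(\<lambda>x. a * f x) \<in> L2 m" "L2_norm m (\<lambda>x. a * f x) \<le> \<bar>a\<bar> * L2_norm m f"
  using L2_le_imp[OF Q_scale[OF L2_le_norm[OF assms]]] .

lemma L2_norm_scale: 
  assumes "f \<in> L2 m" shows "L2_norm m (\<lambda>x. a * f x) = \<bar>a\<bar> * L2_norm m f"
proof (cases "a = 0")
  case False
  have "L2_norm m (\<lambda>x. (1 / a) * (a * f x)) \<le> \<bar>1 / a\<bar> * L2_norm m (\<lambda>x. a * f x)"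
    using L2_scale(2)[OF L2_scale(1)[OF assms]] .
  then have "\<bar>a\<bar> * L2_norm m f \<le> L2_norm m (\<lambda>x. a * f x)"
    using False by (simp add: field_simps)
  then show ?thesis using L2_scale(2)[OF assms, of a] by simp
qed (use L2_scale(2)[OF assms, of 0] L2_norm_nonneg[OF L2_scale(1)[OF assms, of 0]] in simp)

lemma L2_zero: "(\<lambda>_. 0) \<in> L2 m" "L2_norm m (\<lambda>_. 0) = 0"
  by (simp_all add: L2_def L2_norm_def L2_inner_def)

lemma L2_diff:
  assumes "f \<in> L2 m" "g \<in> L2 m"
  shows "(\<lambda>x. f x - g x) \<in> L2 m" "L2_norm m (\<lambda>x. f x - g x) \<le> L2_norm m f + L2_norm m g"
    "L2_norm m f \<le> L2_norm m g + L2_norm m (\<lambda>x. f x - g x)"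
proof -
  show *: "(\<lambda>x. f x - g x) \<in> L2 m"
    using L2_add(1)[OF assms(1) L2_scale(1)[OF assms(2), of "-1"]] by simp
  show "L2_norm m (\<lambda>x. f x - g x) \<le> L2_norm m f + L2_norm m g"
    using L2_add(2)[OF assms(1) L2_scale(1)[OF assms(2), of "-1"]] L2_scale(2)[OF assms(2), of "-1"]
    by simp
  show "L2_norm m f \<le> L2_norm m g + L2_norm m (\<lambda>x. f x - g x)"
    using L2_add(2)[OF assms(2) *] by simp
qed

text \<open>The gliding hump argument: if the operator norms \<open>C n\<close> were unbounded, choose \<open>\<nu> k\<close> with
  \<open>C (\<nu> k) \<ge> 4\<^sup>k\<close> and almost norming unit vectors \<open>G k\<close>, and add \<open>\<plusminus> 3\<^bsup>-k\<^esup> G k\<close> successively, the sign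
  being such that the image under \<open>V (\<nu> k)\<close> is at least as large as that of \<open>3\<^bsup>-k\<^esup> G k\<close> alone. The tail after step \<open>k\<close> has norm at
  most \<open>3\<^bsup>-k\<^esup> / 2\<close>, too small to cancel the \<open>k\<close>-th contribution of size \<open>(2 / 3) 3\<^bsup>-k\<^esup> C (\<nu> k)\<close>, so the
  images of the limit are at least \<open>(4 / 3)\<^sup>k / 6\<close>.\<close>

lemma L2_uniform_boundedness:
  fixes V :: "nat \<Rightarrow> ('v \<Rightarrow> real) \<Rightarrow> 'v \<Rightarrow> real"
  assumes maps: "\<And>n f. f \<in> L2 m \<Longrightarrow> V n f \<in> L2 m"
    and lin: "\<And>n f g a b. f \<in> L2 m \<Longrightarrow> g \<in> L2 m \<Longrightarrow>
      V n (\<lambda>x. a * f x + b * g x) = (\<lambda>x. a * V n f x + b * V n g x)"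
    and bdd: "\<And>n. \<exists>C. \<forall>f\<in>L2 m. L2_norm m (V n f) \<le> C * L2_norm m f"
    and ptw: "\<And>f. f \<in> L2 m \<Longrightarrow> \<exists>M. \<forall>n. L2_norm m (V n f) \<le> M"
  shows "\<exists>M. \<forall>n. \<forall>f\<in>L2 m. L2_norm m (V n f) \<le> M * L2_norm m f"
proof (rule ccontr)
  assume unb: "\<not> ?thesis"
  have lin1: "V n (\<lambda>x. a * f x) = (\<lambda>x. a * V n f x)" if "f \<in> L2 m" for n f a
    using lin[OF that that, of n a 0] by simp
  have linadd: "V n (\<lambda>x. f x + g x) = (\<lambda>x. V n f x + V n g x)" if "f \<in> L2 m" "g \<in> L2 m" for n f g
    using lin[OF that, of n 1 1] by simp
  have lindiff: "V n (\<lambda>x. f x - g x) = (\<lambda>x. V n f x - V n g x)" if "f \<in> L2 m" "g \<in> L2 m" for n f g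
    using lin[OF that, of n 1 "-1"] by simp
  have "\<forall>n. \<exists>C g. 0 \<le> C \<and> g \<in> L2 m \<and> L2_norm m g \<le> 1 \<and> 2 / 3 * C \<le> L2_norm m (V n g)
      \<and> (\<forall>f\<in>L2 m. L2_norm m (V n f) \<le> C * L2_norm m f)"
  proof
    fix n
    obtain B where B: "\<And>f. f \<in> L2 m \<Longrightarrow> L2_norm m (V n f) \<le> B * L2_norm m f" using bdd by blast
    define S where "S = (\<lambda>f. L2_norm m (V n f)) ` {f \<in> L2 m. L2_norm m f \<le> 1}"
    have "L2_norm m (V n f) \<le> \<bar>B\<bar>" if "f \<in> L2 m" "L2_norm m f \<le> 1" for f
    proof -
      have "B * L2_norm m f \<le> \<bar>B\<bar> * 1"
        by (rule mult_mono) (use that in auto)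
      then show ?thesis using B[OF that(1)] by simp
    qed
    then have bS: "bdd_above S" unfolding S_def by (auto intro!: bdd_aboveI)
    have zS: "L2_norm m (V n (\<lambda>_. 0)) \<in> S" unfolding S_def using L2_zero by auto
    define C where "C = Sup S"
    have C0: "0 \<le> C"
      using cSup_upper[OF zS bS] L2_norm_nonneg[OF maps[OF L2_zero(1), of n]] by (simp add: C_def)
    have C: "L2_norm m (V n f) \<le> C * L2_norm m f" if f: "f \<in> L2 m" for f
    proof (cases "L2_norm m f = 0")
      case True
      then show ?thesis using B[OF f] by simp
    next
      case False
      define a where "a = 1 / L2_norm m f"
      have pos: "0 < L2_norm m f" using False L2_norm_nonneg[OF f] by linarith
      have "L2_norm m (V n (\<lambda>x. a * f x)) \<in> S"
        unfolding S_def
        by (rule imageI) (use pos in \<open>simp add: L2_scale(1)[OF f] L2_norm_scale[OF f], simp add: a_def\<close>)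
      then have "L2_norm m (V n (\<lambda>x. a * f x)) \<le> C" unfolding C_def by (rule cSup_upper[OF _ bS])
      then have "\<bar>a\<bar> * L2_norm m (V n f) \<le> C"
        by (simp only: lin1[OF f] L2_norm_scale[OF maps[OF f]])
      then show ?thesis using pos by (simp add: a_def field_simps)
    qed
    obtain g where "g \<in> L2 m" "L2_norm m g \<le> 1" "2 / 3 * C \<le> L2_norm m (V n g)"
    proof (cases "C = 0")
      case True
      then show ?thesis using that[of "\<lambda>_. 0"] L2_zero L2_norm_nonneg[OF maps[OF L2_zero(1)]] by simp
    next
      case False
      then have "2 / 3 * C < Sup S" using C0 by (simp add: C_def)
      then obtain s where "s \<in> S" "2 / 3 * C < s" using less_cSup_iff[of S] bS zS by blast
      then show ?thesis using that unfolding S_def by force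
    qed
    then show "\<exists>C g. 0 \<le> C \<and> g \<in> L2 m \<and> L2_norm m g \<le> 1 \<and> 2 / 3 * C \<le> L2_norm m (V n g)
      \<and> (\<forall>f\<in>L2 m. L2_norm m (V n f) \<le> C * L2_norm m f)" using C0 C by blast
  qed
  then obtain C g where Cg: "\<And>n. 0 \<le> C n" "\<And>n. g n \<in> L2 m" "\<And>n. L2_norm m (g n) \<le> 1"
      "\<And>n. 2 / 3 * C n \<le> L2_norm m (V n (g n))"
      "\<And>n f. f \<in> L2 m \<Longrightarrow> L2_norm m (V n f) \<le> C n * L2_norm m f"
    by metis
  have "\<exists>n. 4 ^ k \<le> C n" for k :: nat
  proof (rule ccontr)
    assume "\<nexists>n. 4 ^ k \<le> C n"
    then have *: "C n \<le> 4 ^ k" for n by (meson linear)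
    have "L2_norm m (V n f) \<le> 4 ^ k * L2_norm m f" if "f \<in> L2 m" for n f
      using Cg(5)[OF that, of n] mult_right_mono[OF *[of n] L2_norm_nonneg[OF that]] by linarith
    with unb show False by blast
  qed
  then obtain \<nu> :: "nat \<Rightarrow> nat" where \<nu>: "\<And>k. 4 ^ k \<le> C (\<nu> k)" by metis
  define e :: "nat \<Rightarrow> real" where "e k = (1 / 3) ^ k" for k
  define G where "G k = g (\<nu> k)" for k
  have G: "G k \<in> L2 m" "L2_norm m (G k) \<le> 1" for k unfolding G_def by (rule Cg)+
  have "\<forall>k y. \<exists>s. \<bar>s\<bar> = 1 \<and> (y \<in> L2 m \<longrightarrow>
      e k * L2_norm m (V (\<nu> k) (G k)) \<le> L2_norm m (V (\<nu> k) (\<lambda>x. y x + (s * e k) * G k x)))"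
  proof (intro allI)
    fix k y
    show "\<exists>s. \<bar>s\<bar> = 1 \<and> (y \<in> L2 m \<longrightarrow>
      e k * L2_norm m (V (\<nu> k) (G k)) \<le> L2_norm m (V (\<nu> k) (\<lambda>x. y x + (s * e k) * G k x)))"
    proof (cases "y \<in> L2 m")
      case y: True
      let ?V = "V (\<nu> k)"
      define p where "p s = ?V (\<lambda>x. y x + (s * e k) * G k x)" for s
      have pL2: "p s \<in> L2 m" for s
        unfolding p_def by (intro maps L2_add(1) L2_scale(1) y G)
      have "(\<lambda>x. p 1 x - p (-1) x) = (\<lambda>x. (2 * e k) * ?V (G k) x)"
        unfolding p_def linadd[OF y L2_scale(1)[OF G(1)]] lin1[OF G(1)] by (simp add: fun_eq_iff)
      then have "(2 * e k) * L2_norm m (?V (G k)) \<le> L2_norm m (p 1) + L2_norm m (p (-1))"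
        using L2_diff(2)[OF pL2 pL2, of 1 "-1"] L2_norm_scale[OF maps[OF G(1)], of "2 * e k" "\<nu> k" k]
        by (simp add: e_def)
      then have "e k * L2_norm m (?V (G k)) \<le> L2_norm m (p 1)
          \<or> e k * L2_norm m (?V (G k)) \<le> L2_norm m (p (-1))" by linarith
      then show ?thesis unfolding p_def by (metis abs_1 abs_minus_cancel)
    qed (auto intro: exI[of _ 1])
  qed
  then obtain \<sigma> where \<sigma>: "\<And>k y. \<bar>\<sigma> k y\<bar> = 1" "\<And>k y. y \<in> L2 m \<Longrightarrow>
      e k * L2_norm m (V (\<nu> k) (G k)) \<le> L2_norm m (V (\<nu> k) (\<lambda>x. y x + (\<sigma> k y * e k) * G k x))"
    by metis
  \<comment> \<open>The partial sums of the hump series, with the signs chosen along the way.\<close>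
  define Y where "Y = rec_nat (\<lambda>_. 0) (\<lambda>k y x. y x + (\<sigma> k y * e k) * G k x)"
  have Y0: "Y 0 = (\<lambda>_. 0)" and YS: "Y (Suc k) = (\<lambda>x. Y k x + (\<sigma> k (Y k) * e k) * G k x)" for k
    by (simp_all add: Y_def)
  have YL2: "Y k \<in> L2 m" for k
    by (induction k) (auto simp: Y0 YS L2_zero intro!: L2_add(1) L2_scale(1)[OF G(1)])
  define F where "F k x = (\<sigma> k (Y k) * e k) * G k x" for k x
  have QF: "L2_le m (F k) (e k)" for k
  proof -
    have "L2_le m (F k) (\<bar>\<sigma> k (Y k) * e k\<bar> * 1)"
      unfolding F_def by (rule Q_scale[OF Q_mono[OF L2_le_norm[OF G(1)] G(2)]])
    then show ?thesis by (simp add: abs_mult \<sigma>(1) e_def)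
  qed
  have se: "summable e" unfolding e_def by (rule summable_geometric) simp
  define Z where "Z x = (\<Sum>k. F k x)" for x
  have ZL2: "Z \<in> L2 m" unfolding Z_def[abs_def] by (rule L2_le_imp(1)[OF Q_suminf(2)[OF QF se]])
  define R where "R n x = (\<Sum>k. F (k + n) x)" for n x
  have Y_sum: "Y n x = (\<Sum>k<n. F k x)" for n x
    by (induction n) (simp_all add: Y0 YS F_def)
  have Z_split: "Z = (\<lambda>x. Y n x + R n x)" for n
    using suminf_split_initial_segment[OF Q_suminf(1)[OF QF se], of _ n]
    by (auto simp: Z_def R_def Y_sum fun_eq_iff)
  have R: "R (Suc k) \<in> L2 m" "L2_norm m (R (Suc k)) \<le> e k / 2" for k
  proof -
    have "L2_le m (R (Suc k)) (\<Sum>j. e (j + Suc k))"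
      unfolding R_def[abs_def]
      by (rule Q_suminf(2)[OF QF summable_ignore_initial_segment[OF se]])
    also have "(\<Sum>j. e (j + Suc k)) = (\<Sum>j. e (Suc k) * (1 / 3) ^ j)"
      by (simp add: e_def power_add mult_ac)
    also have "\<dots> = e (Suc k) * (\<Sum>j. (1 / 3) ^ j)"
      by (rule suminf_mult) (rule summable_geometric, simp)
    also have "\<dots> = e k / 2"
      by (subst suminf_geometric) (simp_all add: e_def)
    finally show "R (Suc k) \<in> L2 m" "L2_norm m (R (Suc k)) \<le> e k / 2"
      using L2_le_imp by blast+
  qed
  obtain M where M: "\<And>n. L2_norm m (V n Z) \<le> M" using ptw[OF ZL2] by blast
  have large: "(4 / 3) ^ k / 6 \<le> M" for k
  proof -
    let ?V = "V (\<nu> k)"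
    have "e k * (2 / 3 * C (\<nu> k)) \<le> e k * L2_norm m (?V (G k))"
      using Cg(4)[of "\<nu> k"] by (intro mult_left_mono) (auto simp: G_def e_def)
    also have "\<dots> \<le> L2_norm m (?V (Y (Suc k)))" using \<sigma>(2)[OF YL2, of k] by (simp add: YS)
    also have "?V (Y (Suc k)) = (\<lambda>x. ?V Z x - ?V (R (Suc k)) x)"
    proof -
      have "Y (Suc k) = (\<lambda>x. Z x - R (Suc k) x)" by (subst Z_split[of "Suc k"]) simp
      then show ?thesis using lindiff[OF ZL2 R(1)] by simp
    qed
    also have "L2_norm m \<dots> \<le> L2_norm m (?V Z) + L2_norm m (?V (R (Suc k)))"
      by (rule L2_diff(2)[OF maps[OF ZL2] maps[OF R(1)]])
    also have "\<dots> \<le> M + C (\<nu> k) * (e k / 2)"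
      using M[of "\<nu> k"] Cg(5)[OF R(1), of "\<nu> k" k] mult_left_mono[OF R(2)[of k] Cg(1)[of "\<nu> k"]]
      by linarith
    finally have *: "e k * C (\<nu> k) / 6 \<le> M" by (simp add: algebra_simps)
    have "(4 / 3 :: real) ^ k = e k * 4 ^ k" by (simp add: e_def power_divide)
    also have "\<dots> \<le> e k * C (\<nu> k)" using \<nu>[of k] by (intro mult_left_mono) (auto simp: e_def)
    finally show ?thesis using * by simp
  qed
  obtain k where "6 * M < (4 / 3 :: real) ^ k" using real_arch_pow[of "4 / 3" "6 * M"] by auto
  with large[of k] show False by simp
qed

section \<open>Uniqueness of the semigroup with a given bounded generator\<close>

text \<open>For each \<open>f\<close> the quotients \<open>(T\<^sub>h f - f) / h\<close> converge as \<open>h\<close> tends to \<open>0\<close>, so along every null sequence they are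
  bounded, and uniform boundedness applies.\<close>

lemma difference_quotients_bounded:
  assumes C0: "C0_semigroup m T"
    and gen: "\<And>f. f \<in> L2 m \<Longrightarrow> Af f \<in> L2 m \<and>
      ((\<lambda>t. L2_norm m (\<lambda>x. (T t f x - f x) / t - Af f x)) \<longlongrightarrow> 0) (at_right 0)"
  shows "\<exists>\<delta>>0. \<exists>M\<ge>0. \<forall>h. 0 < h \<and> h \<le> \<delta> \<longrightarrow>
    (\<forall>f\<in>L2 m. L2_norm m (\<lambda>x. T h f x - f x) \<le> M * h * L2_norm m f)"
proof (rule ccontr)
  assume neg: "\<not> ?thesis"
  have TL2: "T t f \<in> L2 m" if "0 \<le> t" "f \<in> L2 m" for t f
    using C0 that unfolding C0_semigroup_def by blast
  have Tlin: "T t (\<lambda>x. a * f x + b * g x) = (\<lambda>x. a * T t f x + b * T t g x)"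
    if "0 \<le> t" "f \<in> L2 m" "g \<in> L2 m" for t f g a b
    using C0 that unfolding C0_semigroup_def by blast
  have Tbd: "\<exists>C. \<forall>f\<in>L2 m. L2_norm m (T t f) \<le> C * L2_norm m f" if "0 \<le> t" for t
    using C0 that unfolding C0_semigroup_def by blast
  have "\<exists>h f. 0 < h \<and> h \<le> 1 / real (Suc n) \<and> f \<in> L2 m \<and>
      real n * h * L2_norm m f < L2_norm m (\<lambda>x. T h f x - f x)" for n
  proof (rule ccontr)
    assume "\<not> ?thesis"
    then have "\<forall>h. 0 < h \<and> h \<le> 1 / real (Suc n) \<longrightarrow>
      (\<forall>f\<in>L2 m. L2_norm m (\<lambda>x. T h f x - f x) \<le> real n * h * L2_norm m f)"
      by (meson linorder_not_less)
    moreover have "0 < 1 / real (Suc n)" "0 \<le> real n" by simp_all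
    ultimately show False using neg by blast
  qed
  then obtain h F where h: "\<And>n. 0 < h n" "\<And>n. h n \<le> 1 / real (Suc n)" and F: "\<And>n. F n \<in> L2 m"
    "\<And>n. real n * h n * L2_norm m (F n) < L2_norm m (\<lambda>x. T (h n) (F n) x - F n x)"
    by metis
  define V where "V n f x = (1 / h n) * (T (h n) f x - f x)" for n f x
  have h0: "0 \<le> h n" for n using h(1)[of n] by simp
  have dL2: "(\<lambda>x. T (h n) f x - f x) \<in> L2 m" if "f \<in> L2 m" for n f
    by (rule L2_diff(1)[OF TL2[OF h0 that] that])
  have VN: "L2_norm m (V n f) = (1 / h n) * L2_norm m (\<lambda>x. T (h n) f x - f x)" if "f \<in> L2 m" for n f
    using L2_norm_scale[OF dL2[OF that], of "1 / h n" n] h(1)[of n] by (simp add: V_def[abs_def])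
  have "\<exists>M. \<forall>n. \<forall>f\<in>L2 m. L2_norm m (V n f) \<le> M * L2_norm m f"
  proof (rule L2_uniform_boundedness)
    show "V n f \<in> L2 m" if "f \<in> L2 m" for n f
      unfolding V_def[abs_def] by (rule L2_scale(1)[OF dL2[OF that]])
    show "V n (\<lambda>x. a * f x + b * g x) = (\<lambda>x. a * V n f x + b * V n g x)"
      if "f \<in> L2 m" "g \<in> L2 m" for n f g a b
      unfolding V_def[abs_def] Tlin[OF h0 that] by (simp add: algebra_simps)
    show "\<exists>C. \<forall>f\<in>L2 m. L2_norm m (V n f) \<le> C * L2_norm m f" for n
    proof -
      obtain C where C: "\<And>f. f \<in> L2 m \<Longrightarrow> L2_norm m (T (h n) f) \<le> C * L2_norm m f"
        using Tbd[OF h0] by blast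
      have "L2_norm m (V n f) \<le> (1 / h n * (C + 1)) * L2_norm m f" if "f \<in> L2 m" for f
      proof -
        have "L2_norm m (\<lambda>x. T (h n) f x - f x) \<le> (C + 1) * L2_norm m f"
          using L2_diff(2)[OF TL2[OF h0 that] that, of n] C[OF that] by (simp add: algebra_simps)
        then have "1 / h n * L2_norm m (\<lambda>x. T (h n) f x - f x) \<le> 1 / h n * ((C + 1) * L2_norm m f)"
          by (rule mult_left_mono) (use h0 in simp)
        then show ?thesis unfolding VN[OF that] by (simp add: mult.assoc)
      qed
      then show ?thesis by blast
    qed
    show "\<exists>M. \<forall>n. L2_norm m (V n f) \<le> M" if f: "f \<in> L2 m" for f
    proof -
      \<comment> \<open>The sequence witnessing unboundedness tends to 0 because it was chosen below \<open>1 / (n + 1)\<close>.\<close>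
      have lim: "filterlim h (at_right 0) sequentially"
        unfolding filterlim_at
      proof
        show "\<forall>\<^sub>F n in sequentially. h n \<in> {0<..} \<and> h n \<noteq> 0" using h(1) by (simp add: less_imp_neq[symmetric])
        show "h \<longlonglongrightarrow> 0"
          by (rule tendsto_sandwich[OF _ _ tendsto_const LIMSEQ_inverse_real_of_nat])
             (use h h0 in \<open>auto simp: inverse_eq_divide\<close>)
      qed
      have "(\<lambda>n. L2_norm m (\<lambda>x. (T (h n) f x - f x) / h n - Af f x)) \<longlonglongrightarrow> 0"
        using filterlim_compose[OF conjunct2[OF gen[OF f]] lim] .
      then have "Bseq (\<lambda>n. L2_norm m (\<lambda>x. V n f x - Af f x))"
        by (intro convergent_imp_Bseq convergentI) (simp add: V_def)
      then obtain K where K: "\<And>n. norm (L2_norm m (\<lambda>x. V n f x - Af f x)) \<le> K"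
        by (auto simp: Bseq_def)
      have "L2_norm m (V n f) \<le> L2_norm m (Af f) + K" for n
      proof -
        have "V n f \<in> L2 m" unfolding V_def[abs_def] by (rule L2_scale(1)[OF dL2[OF f]])
        then show ?thesis using L2_diff(3)[of "V n f" "Af f"] gen[OF f] K[of n] by force
      qed
      then show ?thesis by blast
    qed
  qed
  then obtain M where M: "\<And>n f. f \<in> L2 m \<Longrightarrow> L2_norm m (V n f) \<le> M * L2_norm m f" by blast
  obtain n :: nat where n: "M < real n" using reals_Archimedean2 by blast
  have "(1 / h n) * L2_norm m (\<lambda>x. T (h n) (F n) x - F n x) \<le> M * L2_norm m (F n)"
    using M[OF F(1), of n n] VN[OF F(1), of n n] by simp
  also have "\<dots> \<le> real n * L2_norm m (F n)" using n F(1) by (intro mult_right_mono) auto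
  finally have "L2_norm m (\<lambda>x. T (h n) (F n) x - F n x) \<le> real n * h n * L2_norm m (F n)"
    using h(1)[of n] by (simp add: field_simps)
  then show False using F(2)[of n] by simp
qed

text \<open>Split \<open>t\<close> into equal steps of length at most \<open>\<delta>\<close>, each of which costs a factor \<open>1 + M h \<le> e\<^bsup>Mh\<^esup>\<close>.\<close>

lemma C0_semigroup_growth:
  assumes C0: "C0_semigroup m T" and "0 < \<delta>" "0 \<le> M"
    and bd: "\<forall>h. 0 < h \<and> h \<le> \<delta> \<longrightarrow>
      (\<forall>f\<in>L2 m. L2_norm m (\<lambda>x. T h f x - f x) \<le> M * h * L2_norm m f)"
    and t: "0 \<le> t" and f: "f \<in> L2 m"
  shows "L2_norm m (T t f) \<le> exp (M * t) * L2_norm m f"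
proof -
  have TL2: "T t f \<in> L2 m" if "0 \<le> t" "f \<in> L2 m" for t f
    using C0 that unfolding C0_semigroup_def by blast
  have T0: "T 0 f = f" if "f \<in> L2 m" for f using C0 that unfolding C0_semigroup_def by blast
  have Tadd: "T (s + t) f = T s (T t f)" if "0 \<le> s" "0 \<le> t" "f \<in> L2 m" for s t f
    using C0 that unfolding C0_semigroup_def by blast
  show ?thesis
  proof (cases "t = 0")
    case True then show ?thesis using T0[OF f] by simp
  next
    case False
    then have tpos: "0 < t" using t by simp
    obtain n :: nat where n: "t / \<delta> < real n" using reals_Archimedean2 by blast
    define h where "h = t / real n"
    have npos: "0 < real n" using n tpos \<open>0 < \<delta>\<close> by (meson divide_pos_pos less_trans)
    have h: "0 < h" "h \<le> \<delta>"
      using n npos tpos \<open>0 < \<delta>\<close> by (auto simp: h_def field_simps)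
    have step: "L2_norm m (T h g) \<le> exp (M * h) * L2_norm m g" if g: "g \<in> L2 m" for g
    proof -
      have "L2_norm m (T h g) \<le> L2_norm m g + M * h * L2_norm m g"
        using L2_diff(3)[OF TL2[OF less_imp_le[OF h(1)] g] g] bd h g by fastforce
      also have "\<dots> = (1 + M * h) * L2_norm m g" by (simp add: algebra_simps)
      also have "\<dots> \<le> exp (M * h) * L2_norm m g"
        using exp_ge_add_one_self[of "M * h"] g by (intro mult_right_mono) auto
      finally show ?thesis .
    qed
    have "L2_norm m (T (real k * h) f) \<le> exp (M * (real k * h)) * L2_norm m f" for k
    proof (induction k)
      case 0 then show ?case using T0[OF f] by simp
    next
      case (Suc k)
      have kh: "0 \<le> real k * h" using h by simp
      have "T (real (Suc k) * h) f = T h (T (real k * h) f)"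
        using Tadd[OF less_imp_le[OF h(1)] kh f] by (simp add: algebra_simps)
      then have "L2_norm m (T (real (Suc k) * h) f) \<le> exp (M * h) * L2_norm m (T (real k * h) f)"
        using step[OF TL2[OF kh f]] by simp
      also have "\<dots> \<le> exp (M * h) * (exp (M * (real k * h)) * L2_norm m f)"
        by (rule mult_left_mono[OF Suc]) simp
      also have "\<dots> = exp (M * (real (Suc k) * h)) * L2_norm m f"
      proof -
        have e: "M * (real (Suc k) * h) = M * h + M * (real k * h)" by (simp add: algebra_simps)
        show ?thesis unfolding e exp_add by (simp only: mult.assoc)
      qed
      finally show ?case .
    qed
    from this[of n] show ?thesis using npos by (simp add: h_def)
  qed
qed

text \<open>The generator only provides the right derivative at \<open>0\<close>. On the right of \<open>s\<close> one factors out \<open>T\<^sub>s\<close>; on the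
  left one factors out \<open>T\<^bsub>s-h\<^esub>\<close>, which varies with \<open>h\<close>, and this is where the uniform growth bound and the
  Lipschitz estimate enter.\<close>

lemma C0_semigroup_DERIV:
  assumes C0: "C0_semigroup m T" and "0 < \<delta>" "0 \<le> M"
    and bd: "\<forall>h. 0 < h \<and> h \<le> \<delta> \<longrightarrow>
      (\<forall>f\<in>L2 m. L2_norm m (\<lambda>x. T h f x - f x) \<le> M * h * L2_norm m f)"
    and f: "f \<in> L2 m" and g: "g \<in> L2 m"
    and gen: "((\<lambda>t. L2_norm m (\<lambda>x. (T t f x - f x) / t - g x)) \<longlongrightarrow> 0) (at_right 0)"
    and s: "0 < s"
  shows "((\<lambda>s. T s f x) has_real_derivative T s g x) (at s)"
proof -
  have TL2: "T t f \<in> L2 m" if "0 \<le> t" "f \<in> L2 m" for t f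
    using C0 that unfolding C0_semigroup_def by blast
  have Tlin: "T t (\<lambda>x. a * f x + b * g x) = (\<lambda>x. a * T t f x + b * T t g x)"
    if "0 \<le> t" "f \<in> L2 m" "g \<in> L2 m" for t f g a b
    using C0 that unfolding C0_semigroup_def by blast
  have Tadd: "T (s + t) f = T s (T t f)" if "0 \<le> s" "0 \<le> t" "f \<in> L2 m" for s t f
    using C0 that unfolding C0_semigroup_def by blast
  note growth = C0_semigroup_growth[OF C0 \<open>0 < \<delta>\<close> \<open>0 \<le> M\<close> bd]
  define \<kappa> where "\<kappa> = 1 / sqrt (m x)"
  have \<kappa>: "0 \<le> \<kappa>" using m_pos[of x] by (simp add: \<kappa>_def)
  have point: "\<bar>T r u x\<bar> \<le> \<kappa> * (exp (M * s) * L2_norm m u)" if "0 \<le> r" "r \<le> s" "u \<in> L2 m" for r u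
  proof -
    have "\<bar>T r u x\<bar> \<le> \<kappa> * L2_norm m (T r u)"
      unfolding \<kappa>_def by (rule L2_point[OF TL2[OF that(1,3)]])
    also have "L2_norm m (T r u) \<le> exp (M * r) * L2_norm m u" by (rule growth[OF that(1,3)])
    also have "\<dots> \<le> exp (M * s) * L2_norm m u"
      using that \<open>0 \<le> M\<close> by (intro mult_right_mono) (auto intro: mult_left_mono)
    finally show ?thesis using \<kappa> by (simp add: mult_left_mono)
  qed
  define err where "err h = L2_norm m (\<lambda>x. (T h f x - f x) / h - g x)" for h
  have err: "(err \<longlongrightarrow> 0) (at_right 0)" unfolding err_def[abs_def] by (rule gen)
  have quot: "\<bar>(T (r + h) f x - T r f x) / h - T r g x\<bar> \<le> \<kappa> * (exp (M * s) * err h)"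
    if r: "0 \<le> r" "r \<le> s" and h: "0 < h" for r h
  proof -
    have h0: "0 \<le> h" using h by simp
    have fh: "(\<lambda>x. 1 / h * T h f x + (- 1 / h) * f x) \<in> L2 m"
      by (intro L2_add(1) L2_scale(1) TL2 h0 f)
    have e1: "T r (\<lambda>x. 1 * (1 / h * T h f x + (- 1 / h) * f x) + (-1) * g x) x
        = (T (r + h) f x - T r f x) / h - T r g x"
      unfolding Tlin[OF r(1) fh g] Tlin[OF r(1) TL2[OF h0 f] f] Tadd[OF r(1) h0 f]
      by (simp add: diff_divide_distrib)
    have e2: "(\<lambda>x. 1 * (1 / h * T h f x + (- 1 / h) * f x) + (-1) * g x)
        = (\<lambda>x. (T h f x - f x) / h - g x)"
      by (simp add: diff_divide_distrib)
    have e3: "(\<lambda>x. (T h f x - f x) / h - g x) \<in> L2 m"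
      using L2_diff(1)[OF fh g] by (simp add: diff_divide_distrib)
    show ?thesis using point[OF r e3] unfolding e1[unfolded e2, symmetric] err_def .
  qed
  have right: "((\<lambda>h. (T (s + h) f x - T s f x) / h) \<longlongrightarrow> T s g x) (at_right 0)"
  proof (rule LIM_zero_cancel, rule Lim_null_comparison)
    show "\<forall>\<^sub>F h in at_right 0. norm ((T (s + h) f x - T s f x) / h - T s g x)
        \<le> \<kappa> * (exp (M * s) * err h)"
      using eventually_at_right_less[of "0::real"] by eventually_elim (use quot s in auto)
    show "((\<lambda>h. \<kappa> * (exp (M * s) * err h)) \<longlongrightarrow> 0) (at_right 0)"
      by (intro tendsto_mult_right_zero err)
  qed
  have left: "((\<lambda>h. (T (s + h) f x - T s f x) / h) \<longlongrightarrow> T s g x) (at_left 0)"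
  proof -
    have "((\<lambda>h. (T (s + - h) f x - T s f x) / - h) \<longlongrightarrow> T s g x) (at_right 0)"
    proof (rule LIM_zero_cancel, rule Lim_null_comparison)
      have "\<forall>\<^sub>F h in at_right 0. h < s" "\<forall>\<^sub>F h in at_right 0. h < \<delta>"
        using order_tendstoD(2)[OF tendsto_ident_at s] order_tendstoD(2)[OF tendsto_ident_at \<open>0 < \<delta>\<close>]
        by simp_all
      then show "\<forall>\<^sub>F h in at_right 0. norm ((T (s + - h) f x - T s f x) / - h - T s g x)
        \<le> \<kappa> * (exp (M * s) * err h) + \<kappa> * (exp (M * s) * (M * h * L2_norm m g))"
        using eventually_at_right_less[of "0::real"]
      proof eventually_elim
        case (elim h)
        then have r: "0 \<le> s - h" "s - h \<le> s" and h: "0 < h" "h \<le> \<delta>" "0 \<le> h" by auto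
        have 1: "\<bar>(T s f x - T (s - h) f x) / h - T (s - h) g x\<bar> \<le> \<kappa> * (exp (M * s) * err h)"
          using quot[OF r h(1)] by simp
        have gL2: "(\<lambda>x. T h g x - g x) \<in> L2 m" by (rule L2_diff(1)[OF TL2[OF h(3) g] g])
        have "T (s - h) (\<lambda>x. 1 * T h g x + (-1) * g x) x = T s g x - T (s - h) g x"
          unfolding Tlin[OF r(1) TL2[OF h(3) g] g] Tadd[OF r(1) h(3) g, symmetric] by simp
        then have "\<bar>T s g x - T (s - h) g x\<bar> \<le> \<kappa> * (exp (M * s) * L2_norm m (\<lambda>x. T h g x - g x))"
          using point[OF r gL2] by simp
        also have "\<dots> \<le> \<kappa> * (exp (M * s) * (M * h * L2_norm m g))"
          using \<kappa> bd h(1,2) g by (intro mult_left_mono) auto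
        finally have 2: "\<bar>T s g x - T (s - h) g x\<bar> \<le> \<kappa> * (exp (M * s) * (M * h * L2_norm m g))" .
        have "(T (s + - h) f x - T s f x) / - h = (T s f x - T (s - h) f x) / h"
          using h(1) by (simp add: field_simps)
        then show ?case using 1 2 unfolding real_norm_def by linarith
      qed
      have "((\<lambda>h. \<kappa> * (exp (M * s) * err h) + \<kappa> * (exp (M * s) * (M * h * L2_norm m g))) \<longlongrightarrow>
        \<kappa> * (exp (M * s) * 0) + \<kappa> * (exp (M * s) * (M * 0 * L2_norm m g))) (at_right 0)"
        by (intro tendsto_intros err)
      then show "((\<lambda>h. \<kappa> * (exp (M * s) * err h) + \<kappa> * (exp (M * s) * (M * h * L2_norm m g)))
        \<longlongrightarrow> 0) (at_right 0)" by simp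
    qed
    then show ?thesis unfolding filterlim_at_left_to_right[of _ _ 0] minus_zero .
  qed
  show ?thesis using filterlim_split_at[OF left right] by (simp only: DERIV_def)
qed

text \<open>The derivatives of \<open>s \<mapsto> T\<^sub>s f (x)\<close> are \<open>T\<^sub>s (A\<^sup>k f) (x)\<close>, which grow at most like \<open>c\<^sup>k\<close>. The Taylor
  expansion is taken at a point \<open>\<epsilon> > 0\<close>, where the orbit is differentiable from both sides, and \<open>\<epsilon>\<close> is sent to \<open>0\<close>
  before the order is sent to infinity.\<close>

lemma C0_semigroup_eq_op_exp:
  assumes C0: "C0_semigroup m T"
    and A: "gauged_operator (L2_le m) (\<lambda>x. 1 / sqrt (m x)) A c"
    and gen: "\<And>f. f \<in> L2 m \<Longrightarrow>
      ((\<lambda>t. L2_norm m (\<lambda>x. (T t f x - f x) / t - A f x)) \<longlongrightarrow> 0) (at_right 0)"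
    and t: "0 \<le> t" and f: "f \<in> L2 m"
  shows "T t f x = op_exp A t f x"
proof (cases "t = 0")
  case True
  then show ?thesis using C0 f unfolding C0_semigroup_def by simp
next
  case False
  then have t: "0 < t" using t by simp
  interpret A: gauged_operator "L2_le m" "\<lambda>x. 1 / sqrt (m x)" A c by (rule A)
  have pL2: "(A ^^ k) f \<in> L2 m" "L2_norm m ((A ^^ k) f) \<le> L2_norm m f * c ^ k" for k
    using L2_le_imp[OF A.Q_power[OF L2_le_norm[OF f]]] .
  have AL2: "A u \<in> L2 m" if "u \<in> L2 m" for u
    using L2_le_imp(1)[OF A.Q_A[OF L2_le_norm[OF that]]] .
  have "\<exists>\<delta>>0. \<exists>M\<ge>0. \<forall>h. 0 < h \<and> h \<le> \<delta> \<longrightarrow>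
      (\<forall>f\<in>L2 m. L2_norm m (\<lambda>x. T h f x - f x) \<le> M * h * L2_norm m f)"
    by (rule difference_quotients_bounded[OF C0 conjI[OF AL2 gen]])
  then obtain \<delta> M where \<delta>: "0 < \<delta>" "0 \<le> M" and bd: "\<forall>h. 0 < h \<and> h \<le> \<delta> \<longrightarrow>
      (\<forall>f\<in>L2 m. L2_norm m (\<lambda>x. T h f x - f x) \<le> M * h * L2_norm m f)"
    by blast
  define \<kappa> where "\<kappa> = 1 / sqrt (m x)"
  have \<kappa>: "0 \<le> \<kappa>" using m_pos[of x] by (simp add: \<kappa>_def)
  have TL2: "T t f \<in> L2 m" if "0 \<le> t" "f \<in> L2 m" for t f
    using C0 that unfolding C0_semigroup_def by blast
  define B where "B n = \<kappa> * exp (M * t) * L2_norm m f * ((t * c) ^ n / fact n)" for n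
  have taylor: "\<bar>T t f x - (\<Sum>k<n. T \<epsilon> ((A ^^ k) f) x / fact k * (t - \<epsilon>) ^ k)\<bar> \<le> B n"
    if \<epsilon>: "0 < \<epsilon>" "\<epsilon> < t" and n: "0 < n" for \<epsilon> n
  proof -
    have "\<exists>s>\<epsilon>. s < t \<and> T t f x =
        (\<Sum>k<n. T \<epsilon> ((A ^^ k) f) x / fact k * (t - \<epsilon>) ^ k) + T s ((A ^^ n) f) x / fact n * (t - \<epsilon>) ^ n"
    proof (rule Taylor_up[where diff = "\<lambda>k s. T s ((A ^^ k) f) x" and f = "\<lambda>s. T s f x", OF n])
      show "\<forall>k s. k < n \<and> \<epsilon> \<le> s \<and> s \<le> t \<longrightarrow>
          ((\<lambda>s. T s ((A ^^ k) f) x) has_real_derivative T s ((A ^^ Suc k) f) x) (at s)"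
        using C0_semigroup_DERIV[OF C0 \<delta> bd pL2(1) AL2[OF pL2(1)] gen[OF pL2(1)]] \<epsilon> by simp
    qed (use \<epsilon> in auto)
    then obtain s where s: "\<epsilon> < s" "s < t" and eq: "T t f x =
        (\<Sum>k<n. T \<epsilon> ((A ^^ k) f) x / fact k * (t - \<epsilon>) ^ k) + T s ((A ^^ n) f) x / fact n * (t - \<epsilon>) ^ n"
      by blast
    have s0: "0 \<le> s" using s \<epsilon> by simp
    have "\<bar>T s ((A ^^ n) f) x\<bar> \<le> \<kappa> * L2_norm m (T s ((A ^^ n) f))"
      unfolding \<kappa>_def by (rule L2_point[OF TL2[OF s0 pL2(1)]])
    also have "\<dots> \<le> \<kappa> * (exp (M * s) * L2_norm m ((A ^^ n) f))"
      by (rule mult_left_mono[OF C0_semigroup_growth[OF C0 \<delta> bd s0 pL2(1)] \<kappa>])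
    also have "\<dots> \<le> \<kappa> * (exp (M * t) * (L2_norm m f * c ^ n))"
    proof (rule mult_left_mono[OF mult_mono[OF _ pL2(2)] \<kappa>])
      show "exp (M * s) \<le> exp (M * t)" using s \<delta> by (simp add: mult_left_mono)
    qed (simp_all add: pL2(1))
    finally have "\<bar>T s ((A ^^ n) f) x\<bar> / fact n * (t - \<epsilon>) ^ n
        \<le> \<kappa> * (exp (M * t) * (L2_norm m f * c ^ n)) / fact n * t ^ n"
      using \<epsilon> f \<kappa> A.c_nonneg by (intro mult_mono[OF divide_right_mono power_mono]) auto
    then show ?thesis unfolding eq B_def using \<epsilon>
      by (simp add: abs_mult power_abs power_mult_distrib mult_ac)
  qed
  have cont: "((\<lambda>\<epsilon>. T \<epsilon> u x) \<longlongrightarrow> u x) (at_right 0)" if u: "u \<in> L2 m" for u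
  proof (rule LIM_zero_cancel, rule Lim_null_comparison)
    show "\<forall>\<^sub>F h in at_right 0. norm (T h u x - u x) \<le> \<kappa> * L2_norm m (\<lambda>x. T h u x - u x)"
      using eventually_at_right_less[of "0::real"]
    proof eventually_elim
      case (elim h)
      show ?case using L2_point[OF L2_diff(1)[OF TL2[of h u] u], of x] elim u by (simp add: \<kappa>_def)
    qed
    have "((\<lambda>t. L2_norm m (\<lambda>x. T t u x - u x)) \<longlongrightarrow> 0) (at_right 0)"
      using C0 u unfolding C0_semigroup_def by blast
    then show "((\<lambda>h. \<kappa> * L2_norm m (\<lambda>x. T h u x - u x)) \<longlongrightarrow> 0) (at_right 0)"
      by (rule tendsto_mult_right_zero)
  qed
  have taylor0: "\<bar>T t f x - (\<Sum>k<n. t ^ k / fact k * (A ^^ k) f x)\<bar> \<le> B n" if n: "0 < n" for n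
  proof (rule tendsto_upperbound)
    show "((\<lambda>\<epsilon>. \<bar>T t f x - (\<Sum>k<n. T \<epsilon> ((A ^^ k) f) x / fact k * (t - \<epsilon>) ^ k)\<bar>)
        \<longlongrightarrow> \<bar>T t f x - (\<Sum>k<n. t ^ k / fact k * (A ^^ k) f x)\<bar>) (at_right 0)"
    proof -
      have "((\<lambda>\<epsilon>. \<bar>T t f x - (\<Sum>k<n. T \<epsilon> ((A ^^ k) f) x / fact k * (t - \<epsilon>) ^ k)\<bar>)
        \<longlongrightarrow> \<bar>T t f x - (\<Sum>k<n. (A ^^ k) f x / fact k * (t - 0) ^ k)\<bar>) (at_right 0)"
        by (intro tendsto_intros cont[OF pL2(1)]) auto
      then show ?thesis by (simp add: mult_ac)
    qed
    have "\<forall>\<^sub>F \<epsilon> in at_right 0. \<epsilon> < t"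
      using t by (rule order_tendstoD(2)[OF tendsto_ident_at])
    then show "\<forall>\<^sub>F \<epsilon> in at_right 0. \<bar>T t f x - (\<Sum>k<n. T \<epsilon> ((A ^^ k) f) x / fact k * (t - \<epsilon>) ^ k)\<bar> \<le> B n"
      using eventually_at_right_less[of "0::real"] by eventually_elim (use taylor n in auto)
  qed simp
  have "(\<lambda>n. (t * c) ^ n / fact n) \<longlonglongrightarrow> 0"
  proof -
    have "(\<lambda>n. (t * c) ^ n / fact n) = (\<lambda>n. inverse (fact n) * (t * c) ^ n)"
      by (rule ext) (simp add: divide_inverse)
    then show ?thesis using summable_LIMSEQ_zero[OF summable_exp[of "t * c"]] by (simp only:)
  qed
  then have "(\<lambda>n. B n) \<longlonglongrightarrow> 0" unfolding B_def by (rule tendsto_mult_right_zero)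
  then have "(\<lambda>n. T t f x - (\<Sum>k<n. t ^ k / fact k * (A ^^ k) f x)) \<longlonglongrightarrow> 0"
    by (rule Lim_null_comparison[rotated], intro eventually_sequentiallyI[of 1])
       (use taylor0 in simp)
  moreover have "(\<lambda>n. T t f x - (\<Sum>k<n. t ^ k / fact k * (A ^^ k) f x)) \<longlonglongrightarrow> T t f x - op_exp A t f x"
    unfolding op_exp_def
    by (rule tendsto_diff[OF tendsto_const summable_LIMSEQ[OF A.term_summable[OF L2_le_norm[OF f]]]])
  ultimately have "0 = T t f x - op_exp A t f x" by (rule LIMSEQ_unique)
  then show ?thesis by simp
qed

section \<open>The exponential series as a semigroup on L2\<close>

text \<open>The remainder of the series after the linear term is of order \<open>t\<^sup>2\<close> in norm.\<close>

lemma op_exp_difference_quotient: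
  assumes A: "gauged_operator (L2_le m) (\<lambda>x. 1 / sqrt (m x)) A c" and f: "f \<in> L2 m"
  shows "((\<lambda>t. L2_norm m (\<lambda>x. (op_exp A t f x - f x) / t - A f x)) \<longlongrightarrow> 0) (at_right 0)"
proof (rule Lim_null_comparison)
  interpret A: gauged_operator "L2_le m" "\<lambda>x. 1 / sqrt (m x)" A c by (rule A)
  have "0 < 1 / (c + 1)" using A.c_nonneg by simp
  from order_tendstoD(2)[OF tendsto_ident_at this]
  have "\<forall>\<^sub>F t in at_right 0. t < 1 / (c + 1)" .
  then show "\<forall>\<^sub>F t in at_right 0.
      norm (L2_norm m (\<lambda>x. (op_exp A t f x - f x) / t - A f x)) \<le> t * (c\<^sup>2 * L2_norm m f)"
    using eventually_at_right_less[of "0::real"]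
  proof eventually_elim
    case (elim t)
    have "t * c \<le> t * (c + 1)" using elim by simp
    also have "\<dots> \<le> 1" using elim A.c_nonneg by (simp add: field_simps)
    finally have "\<bar>t\<bar> * c \<le> 1" using elim by simp
    from Q_scale[OF A.Q_exp_remainder[OF L2_le_norm[OF f] this], of "1 / t"]
    have "L2_le m (\<lambda>x. (op_exp A t f x - f x) / t - A f x) (t * (c\<^sup>2 * L2_norm m f))"
      using elim by (simp add: field_simps power2_eq_square)
    then show ?case using L2_le_imp[of _ "t * (c\<^sup>2 * L2_norm m f)"] by fastforce
  qed
  have "((\<lambda>t. t * (c\<^sup>2 * L2_norm m f)) \<longlongrightarrow> 0 * (c\<^sup>2 * L2_norm m f)) (at_right 0)"
    by (intro tendsto_intros)
  then show "((\<lambda>t. t * (c\<^sup>2 * L2_norm m f)) \<longlongrightarrow> 0) (at_right 0)" by simp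
qed

lemma generator_op_exp_iff:
  assumes A: "gauged_operator (L2_le m) (\<lambda>x. 1 / sqrt (m x)) A c"
  shows "generator m (op_exp A) f h \<longleftrightarrow> f \<in> L2 m \<and> h = A f"
proof
  interpret A: gauged_operator "L2_le m" "\<lambda>x. 1 / sqrt (m x)" A c by (rule A)
  have AL2: "A u \<in> L2 m" "op_exp A t u \<in> L2 m" if "u \<in> L2 m" for u t
    using L2_le_imp(1)[OF A.Q_A[OF L2_le_norm[OF that]]]
      L2_le_imp(1)[OF A.Q_exp[OF L2_le_norm[OF that]]] by blast+
  show "generator m (op_exp A) f h" if "f \<in> L2 m \<and> h = A f"
    using that AL2 op_exp_difference_quotient[OF A] unfolding generator_def by blast
  assume gen: "generator m (op_exp A) f h"
  then have fh: "f \<in> L2 m" "h \<in> L2 m"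
    and lim: "((\<lambda>t. L2_norm m (\<lambda>x. (op_exp A t f x - f x) / t - h x)) \<longlongrightarrow> 0) (at_right 0)"
    unfolding generator_def by auto
  have quot: "(\<lambda>x. (op_exp A t f x - f x) / t) \<in> L2 m" for t
    using L2_scale(1)[OF L2_diff(1)[OF AL2(2)[OF fh(1)] fh(1)], of "1 / t"] by simp
  have "L2_norm m (\<lambda>x. A f x - h x) \<le> 0"
  proof (rule tendsto_lowerbound)
    show "((\<lambda>t. L2_norm m (\<lambda>x. (op_exp A t f x - f x) / t - h x)
        + L2_norm m (\<lambda>x. (op_exp A t f x - f x) / t - A f x)) \<longlongrightarrow> 0) (at_right 0)"
      using tendsto_add[OF lim op_exp_difference_quotient[OF A fh(1)]] by simp
    show "\<forall>\<^sub>F t in at_right 0. L2_norm m (\<lambda>x. A f x - h x)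
        \<le> L2_norm m (\<lambda>x. (op_exp A t f x - f x) / t - h x)
        + L2_norm m (\<lambda>x. (op_exp A t f x - f x) / t - A f x)"
    proof (rule always_eventually, rule allI)
      fix t
      show "L2_norm m (\<lambda>x. A f x - h x)
        \<le> L2_norm m (\<lambda>x. (op_exp A t f x - f x) / t - h x)
        + L2_norm m (\<lambda>x. (op_exp A t f x - f x) / t - A f x)"
        using L2_diff(2)[OF L2_diff(1)[OF quot fh(2)] L2_diff(1)[OF quot AL2(1)[OF fh(1)]], of t t]
        by simp
    qed
  qed simp
  then have "\<bar>A f x - h x\<bar> \<le> 0" for x
    using L2_point[OF L2_diff(1)[OF AL2(1)[OF fh(1)] fh(2)], of x] m_pos[of x]
      L2_norm_nonneg[OF L2_diff(1)[OF AL2(1)[OF fh(1)] fh(2)]] by simp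
  then have "h = A f" by (auto simp: fun_eq_iff)
  with fh show "f \<in> L2 m \<and> h = A f" by blast
qed

lemma C0_semigroup_op_exp:
  assumes A: "gauged_operator (L2_le m) (\<lambda>x. 1 / sqrt (m x)) A c"
  shows "C0_semigroup m (op_exp A)"
proof -
  interpret A: gauged_operator "L2_le m" "\<lambda>x. 1 / sqrt (m x)" A c by (rule A)
  have S: "op_exp A t u \<in> L2 m" "L2_norm m (op_exp A t u) \<le> exp (\<bar>t\<bar> * c) * L2_norm m u"
    if "u \<in> L2 m" for u t
    using L2_le_imp[OF A.Q_exp[OF L2_le_norm[OF that]]] by blast+
  have "((\<lambda>t. L2_norm m (\<lambda>x. op_exp A t f x - f x)) \<longlongrightarrow> 0) (at_right 0)" if f: "f \<in> L2 m" for f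
  proof (rule Lim_null_comparison)
    let ?err = "\<lambda>t. L2_norm m (\<lambda>x. (op_exp A t f x - f x) / t - A f x)"
    have Af: "A f \<in> L2 m" using L2_le_imp(1)[OF A.Q_A[OF L2_le_norm[OF f]]] .
    have d: "(\<lambda>x. op_exp A t f x - f x) \<in> L2 m" for t by (rule L2_diff(1)[OF S(1)[OF f] f])
    have d': "(\<lambda>x. (op_exp A t f x - f x) / t) \<in> L2 m" for t
      using L2_scale(1)[OF d, of "1 / t" t] by simp
    show "\<forall>\<^sub>F t in at_right 0. norm (L2_norm m (\<lambda>x. op_exp A t f x - f x))
        \<le> t * (L2_norm m (A f) + ?err t)"
      using eventually_at_right_less[of "0::real"]
    proof eventually_elim
      case (elim t)
      have "L2_norm m (\<lambda>x. op_exp A t f x - f x) = t * L2_norm m (\<lambda>x. (op_exp A t f x - f x) / t)"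
        using L2_norm_scale[OF d', of t t] elim by simp
      also have "\<dots> \<le> t * (L2_norm m (A f) + ?err t)"
        using elim by (intro mult_left_mono L2_diff(3)[OF d' Af]) simp
      finally show ?case using L2_norm_nonneg[OF d] by simp
    qed
    have "((\<lambda>t. t * (L2_norm m (A f) + ?err t)) \<longlongrightarrow> 0 * (L2_norm m (A f) + 0)) (at_right 0)"
      by (intro tendsto_mult tendsto_add tendsto_const tendsto_ident_at op_exp_difference_quotient[OF A f])
    then show "((\<lambda>t. t * (L2_norm m (A f) + ?err t)) \<longlongrightarrow> 0) (at_right 0)" by simp
  qed
  moreover have "\<exists>C. \<forall>f\<in>L2 m. L2_norm m (op_exp A t f) \<le> C * L2_norm m f" for t
    using S(2) by blast
  moreover have "op_exp A (s + t) f = op_exp A s (op_exp A t f)" if "f \<in> L2 m" for s t f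
    using A.exp_group[OF L2_le_norm[OF that]] by (simp add: fun_eq_iff)
  moreover have "op_exp A t (\<lambda>x. a * f x + b * g x) = (\<lambda>x. a * op_exp A t f x + b * op_exp A t g x)"
    if "f \<in> L2 m" "g \<in> L2 m" for t f g a b
    using A.exp_lincomb[OF L2_le_norm[OF that(1)] L2_le_norm[OF that(2)]] by (simp add: fun_eq_iff)
  ultimately show ?thesis unfolding C0_semigroup_def using S(1) by simp
qed

lemma L2_mult_summable:
  assumes "f \<in> L2 m" "g \<in> L2 m"
  shows "(\<lambda>x. m x * f x * g x) summable_on UNIV"
proof (rule abs_summable_summable, rule summable_on_comparison_test)
  show "(\<lambda>x. m x * (f x)\<^sup>2 + m x * (g x)\<^sup>2) summable_on UNIV"
    using assms by (intro summable_on_add) (auto simp: L2_def)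
  show "norm (m x * f x * g x) \<le> m x * (f x)\<^sup>2 + m x * (g x)\<^sup>2" for x
  proof -
    have "\<bar>f x * g x\<bar> \<le> (f x)\<^sup>2 + (g x)\<^sup>2"
      using sum_squares_bound[of "\<bar>f x\<bar>" "\<bar>g x\<bar>"] abs_ge_zero[of "f x * g x"]
      unfolding abs_mult power2_abs by linarith
    from mult_left_mono[OF this less_imp_le[OF m_pos[of x]]]
    show ?thesis using m_pos[of x] by (simp add: abs_mult ring_distribs mult.assoc)
  qed
qed simp

end

section \<open>The semigroup of a bounded potential on L2\<close>

text \<open>This is \<open>- (L + W)\<close>, the sign convention being that of a generator.\<close>

definition schroedinger ::
  "('v \<Rightarrow> 'v \<Rightarrow> real) \<Rightarrow> ('v \<Rightarrow> real) \<Rightarrow> ('v \<Rightarrow> real) \<Rightarrow> ('v \<Rightarrow> real) \<Rightarrow> 'v \<Rightarrow> real" where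
  "schroedinger w m W f x = Lap w m f x - W x * f x"

locale bounded_graph =
  fixes w :: "'v::countable \<Rightarrow> 'v \<Rightarrow> real" and m :: "'v \<Rightarrow> real" and D :: real
  assumes mwg: "mwg w m" and Deg_le: "Deg w m x \<le> D" and D_ge_1: "1 \<le> D"
begin

lemma w_nonneg: "0 \<le> w x y" and w_sym: "w x y = w y x" and w_diag: "w x x = 0"
  and mass_pos: "0 < m x" and nbhd_finite: "finite {y. 0 < w x y}"
  using mwg unfolding mwg_def by blast+

sublocale L2_space m by standard (rule mass_pos)

lemma qrate_nonneg: "0 \<le> qrate w m x y"
  using w_nonneg[of x y] m_pos[of x] by (simp add: qrate_def)

lemma Deg_nonneg: "0 \<le> Deg w m x"
  unfolding Deg_def by (intro sum_nonneg qrate_nonneg)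

lemma Lap_eq: "Lap w m f x = (\<Sum>y | 0 < w x y. qrate w m x y * f y) - Deg w m x * f x"
  by (simp add: Lap_def Deg_def sum_subtractf sum_distrib_right right_diff_distrib)

lemma locally_finite_schroedinger: "locally_finite_op (schroedinger w m W)"
  unfolding locally_finite_op_def
proof
  fix x
  let ?N = "{y. 0 < w x y}"
  define b where "b y = (if y = x then - Deg w m x - W x else qrate w m x y)" for y
  have "schroedinger w m W f x = (\<Sum>y\<in>insert x ?N. b y * f y)" for f
  proof -
    have "(\<Sum>y\<in>?N. b y * f y) = (\<Sum>y\<in>?N. qrate w m x y * f y)"
      by (rule sum.cong) (auto simp: b_def w_diag)
    then show ?thesis
      using nbhd_finite[of x] by (simp add: w_diag schroedinger_def Lap_eq b_def algebra_simps)
  qed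
  then show "\<exists>M b. finite M \<and> (\<forall>f. schroedinger w m W f x = (\<Sum>y\<in>M. b y * f y))"
    using nbhd_finite[of x] by (intro exI[of _ "insert x ?N"] exI[of _ b]) simp
qed

lemma weighted_Cauchy_Schwarz:
  "(\<Sum>y | 0 < w x y. qrate w m x y * a y)\<^sup>2 \<le> Deg w m x * (\<Sum>y | 0 < w x y. qrate w m x y * (a y)\<^sup>2)"
proof -
  have "(\<Sum>y | 0 < w x y. sqrt (qrate w m x y) * (sqrt (qrate w m x y) * a y))\<^sup>2
      \<le> (\<Sum>y | 0 < w x y. (sqrt (qrate w m x y))\<^sup>2) * (\<Sum>y | 0 < w x y. (sqrt (qrate w m x y) * a y)\<^sup>2)"
    by (rule Cauchy_Schwarz_ineq_sum)
  then show ?thesis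
    by (simp add: power_mult_distrib qrate_nonneg Deg_def mult.assoc[symmetric])
qed

lemma mass_Deg: "m x * Deg w m x = (\<Sum>y | 0 < w x y. w x y)"
  using m_pos[of x] by (simp add: Deg_def qrate_def sum_distrib_left)

text \<open>By the Cauchy-Schwarz inequality with weights \<open>q(x,\<cdot>)\<close>,
  \<open>m(x) (\<Delta>f(x))\<^sup>2 \<le> 2 D \<Sum>\<^sub>y w(x,y) (f(y)\<^sup>2 + f(x)\<^sup>2)\<close>. Summing over \<open>x\<close>, the symmetry of \<open>w\<close> turns
  the first part into the second, and \<open>\<Sum>\<^sub>y w(x,y) \<le> D m(x)\<close>.\<close>

lemma Lap_L2_le:
  assumes "L2_le m f C" shows "L2_le m (Lap w m f) (2 * D * C)"
  unfolding L2_le_iff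
proof (intro conjI allI impI)
  have C: "0 \<le> C" "\<And>X. finite X \<Longrightarrow> (\<Sum>x\<in>X. m x * (f x)\<^sup>2) \<le> C\<^sup>2"
    using assms by (auto simp: L2_le_iff)
  show "0 \<le> 2 * D * C" using C D_ge_1 by simp
  fix X :: "'v set" assume X: "finite X"
  let ?N = "\<lambda>x. {y. 0 < w x y}"
  have pt: "m x * (Lap w m f x)\<^sup>2 \<le> 2 * D * (\<Sum>y\<in>?N x. w x y * (f y)\<^sup>2) + 2 * D * (D * (m x * (f x)\<^sup>2))" for x
  proof -
    have "(Lap w m f x)\<^sup>2 \<le> Deg w m x * (\<Sum>y\<in>?N x. qrate w m x y * (f y - f x)\<^sup>2)"
      unfolding Lap_def by (rule weighted_Cauchy_Schwarz)
    also have "\<dots> \<le> D * (\<Sum>y\<in>?N x. qrate w m x y * (f y - f x)\<^sup>2)"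
      by (intro mult_right_mono Deg_le sum_nonneg mult_nonneg_nonneg qrate_nonneg) simp
    finally have "m x * (Lap w m f x)\<^sup>2 \<le> m x * (D * (\<Sum>y\<in>?N x. qrate w m x y * (f y - f x)\<^sup>2))"
      using m_pos[of x] by (intro mult_left_mono) auto
    also have "\<dots> = D * (\<Sum>y\<in>?N x. w x y * (f y - f x)\<^sup>2)"
      using m_pos[of x] by (simp add: qrate_def sum_distrib_left)
    also have "\<dots> \<le> D * (\<Sum>y\<in>?N x. 2 * (w x y * (f y)\<^sup>2) + 2 * (f x)\<^sup>2 * w x y)"
    proof (intro mult_left_mono sum_mono)
      fix y
      have "(f y - f x)\<^sup>2 \<le> 2 * (f y)\<^sup>2 + 2 * (f x)\<^sup>2"
        using zero_le_power2[of "f y + f x"] by (simp add: power2_eq_square algebra_simps)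
      from mult_left_mono[OF this w_nonneg[of x y]]
      show "w x y * (f y - f x)\<^sup>2 \<le> 2 * (w x y * (f y)\<^sup>2) + 2 * (f x)\<^sup>2 * w x y"
        by (simp add: algebra_simps)
    qed (use D_ge_1 in simp)
    also have "\<dots> = 2 * D * (\<Sum>y\<in>?N x. w x y * (f y)\<^sup>2) + 2 * D * ((f x)\<^sup>2 * (m x * Deg w m x))"
      by (simp add: mass_Deg sum.distrib sum_distrib_left algebra_simps)
    also have "\<dots> \<le> 2 * D * (\<Sum>y\<in>?N x. w x y * (f y)\<^sup>2) + 2 * D * ((f x)\<^sup>2 * (m x * D))"
      using D_ge_1 m_pos[of x] Deg_le[of x] by (intro add_left_mono mult_left_mono) auto
    finally show ?thesis by (simp add: mult_ac)
  qed
  define Y where "Y = (\<Union>x\<in>X. ?N x)"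
  have Y: "finite Y" unfolding Y_def using X nbhd_finite by blast
  have "(\<Sum>x\<in>X. \<Sum>y\<in>?N x. w x y * (f y)\<^sup>2) \<le> (\<Sum>x\<in>X. \<Sum>y\<in>Y. w x y * (f y)\<^sup>2)"
    by (intro sum_mono sum_mono2 Y) (auto simp: Y_def w_nonneg)
  also have "\<dots> = (\<Sum>y\<in>Y. (\<Sum>x\<in>X. w y x) * (f y)\<^sup>2)"
    unfolding sum_distrib_right by (subst sum.swap) (simp only: w_sym)
  also have "\<dots> \<le> (\<Sum>y\<in>Y. (m y * D) * (f y)\<^sup>2)"
  proof (intro sum_mono mult_right_mono)
    fix y
    have "(\<Sum>x\<in>X. w y x) \<le> (\<Sum>x\<in>X \<union> ?N y. w y x)"
      using X nbhd_finite by (intro sum_mono2) (auto simp: w_nonneg)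
    also have "\<dots> = (\<Sum>x\<in>?N y. w y x)"
    proof (rule sum.mono_neutral_right)
      show "\<forall>x\<in>X \<union> ?N y - ?N y. w y x = 0" using w_nonneg by (auto intro: antisym)
    qed (use X nbhd_finite in auto)
    also have "\<dots> \<le> m y * D" unfolding mass_Deg[symmetric]
      using Deg_le[of y] m_pos[of y] by (intro mult_left_mono) auto
    finally show "(\<Sum>x\<in>X. w y x) \<le> m y * D" .
  qed simp
  also have "\<dots> = D * (\<Sum>y\<in>Y. m y * (f y)\<^sup>2)" by (simp add: sum_distrib_left mult_ac)
  also have "\<dots> \<le> D * C\<^sup>2" using C(2)[OF Y] D_ge_1 by (intro mult_left_mono) auto
  finally have 1: "(\<Sum>x\<in>X. \<Sum>y\<in>?N x. w x y * (f y)\<^sup>2) \<le> D * C\<^sup>2" .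
  have "(\<Sum>x\<in>X. m x * (Lap w m f x)\<^sup>2)
      \<le> 2 * D * (\<Sum>x\<in>X. \<Sum>y\<in>?N x. w x y * (f y)\<^sup>2) + 2 * D * (D * (\<Sum>x\<in>X. m x * (f x)\<^sup>2))"
  proof -
    have "(\<Sum>x\<in>X. m x * (Lap w m f x)\<^sup>2)
        \<le> (\<Sum>x\<in>X. 2 * D * (\<Sum>y\<in>?N x. w x y * (f y)\<^sup>2) + 2 * D * (D * (m x * (f x)\<^sup>2)))"
      by (rule sum_mono) (rule pt)
    then show ?thesis by (simp only: sum.distrib sum_distrib_left[symmetric])
  qed
  also have "\<dots> \<le> 2 * D * (D * C\<^sup>2) + 2 * D * (D * C\<^sup>2)"
    using 1 C(2)[OF X] D_ge_1 by (intro add_mono mult_left_mono) auto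
  finally show "(\<Sum>x\<in>X. m x * (Lap w m f x)\<^sup>2) \<le> (2 * D * C)\<^sup>2"
    by (simp add: power2_eq_square algebra_simps)
qed

lemma potential_L2_le:
  assumes "L2_le m f C" "\<And>x. \<bar>W x\<bar> \<le> B" shows "L2_le m (\<lambda>x. W x * f x) (B * C)"
  unfolding L2_le_iff
proof (intro conjI allI impI)
  have C: "0 \<le> C" "\<And>X. finite X \<Longrightarrow> (\<Sum>x\<in>X. m x * (f x)\<^sup>2) \<le> C\<^sup>2"
    using assms(1) by (auto simp: L2_le_iff)
  have B: "0 \<le> B" using assms(2)[of undefined] by simp
  show "0 \<le> B * C" using B C by simp
  fix X :: "'v set" assume X: "finite X"
  have "(\<Sum>x\<in>X. m x * (W x * f x)\<^sup>2) \<le> (\<Sum>x\<in>X. B\<^sup>2 * (m x * (f x)\<^sup>2))"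
  proof (rule sum_mono)
    fix x
    have "(W x)\<^sup>2 \<le> B\<^sup>2" using assms(2)[of x] B by (simp add: abs_le_square_iff[symmetric])
    then have "(W x)\<^sup>2 * (m x * (f x)\<^sup>2) \<le> B\<^sup>2 * (m x * (f x)\<^sup>2)"
      using m_pos[of x] by (intro mult_right_mono) auto
    then show "m x * (W x * f x)\<^sup>2 \<le> B\<^sup>2 * (m x * (f x)\<^sup>2)" by (simp add: power_mult_distrib mult_ac)
  qed
  also have "\<dots> \<le> B\<^sup>2 * C\<^sup>2"
    unfolding sum_distrib_left[symmetric] using C(2)[OF X] by (intro mult_left_mono) auto
  finally show "(\<Sum>x\<in>X. m x * (W x * f x)\<^sup>2) \<le> (B * C)\<^sup>2" by (simp add: power_mult_distrib)
qed

lemma schroedinger_L2: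
  assumes W: "\<And>x. \<bar>W x\<bar> \<le> B"
  shows "gauged_operator (L2_le m) (\<lambda>x. 1 / sqrt (m x)) (schroedinger w m W) (2 * D + B)"
proof
  show "locally_finite_op (schroedinger w m W)" by (rule locally_finite_schroedinger)
  show "0 \<le> 2 * D + B" using W[of undefined] D_ge_1 by simp
  fix f C assume f: "L2_le m f C"
  have "L2_le m (\<lambda>x. Lap w m f x + (-1) * (W x * f x)) (2 * D * C + \<bar>-1\<bar> * (B * C))"
    by (rule Q_add[OF Lap_L2_le[OF f] Q_scale[OF potential_L2_le[OF f W]]])
  then show "L2_le m (schroedinger w m W f) ((2 * D + B) * C)"
    by (simp add: schroedinger_def[abs_def] algebra_simps)
qed

text \<open>For bounded \<open>W\<close> the form domain is all of \<open>L2\<close>, and testing the form with indicators of vertices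
  determines the operator pointwise.\<close>

lemma form_sum_op_iff:
  assumes W: "\<And>x. \<bar>W x\<bar> \<le> B"
  shows "form_sum_op w m W f h \<longleftrightarrow> f \<in> L2 m \<and> h = (\<lambda>x. - schroedinger w m W f x)"
proof -
  have Wabs: "\<And>x. \<bar>(\<bar>W x\<bar>)\<bar> \<le> B" using W by simp
  have dom: "form_dom m W = L2 m"
  proof -
    have "(\<lambda>x. m x * \<bar>W x\<bar> * (f x)\<^sup>2) summable_on UNIV" if "f \<in> L2 m" for f
      using L2_mult_summable[OF L2_le_imp(1)[OF potential_L2_le[OF L2_le_norm[OF that] Wabs]] that]
      by (simp add: power2_eq_square mult_ac)
    then show ?thesis unfolding form_dom_def by blast
  qed
  have form: "form_sum w m W f g = L2_inner m (\<lambda>x. - schroedinger w m W f x) g"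
    if f: "f \<in> L2 m" and g: "g \<in> L2 m" for f g
  proof -
    have "(\<lambda>x. - Lap w m f x) \<in> L2 m"
      using L2_scale(1)[OF L2_le_imp(1)[OF Lap_L2_le[OF L2_le_norm[OF f]]], of "-1"] by simp
    then have s1: "(\<lambda>x. m x * - Lap w m f x * g x) summable_on UNIV" by (rule L2_mult_summable[OF _ g])
    have s2: "(\<lambda>x. m x * W x * f x * g x) summable_on UNIV"
      using L2_mult_summable[OF L2_le_imp(1)[OF potential_L2_le[OF L2_le_norm[OF f] W]] g]
      by (simp add: mult.assoc)
    show ?thesis
      unfolding form_sum_def L2_inner_def infsum_add[OF s1 s2, symmetric] schroedinger_def
      by (simp add: algebra_simps)
  qed
  have SL2: "(\<lambda>x. - schroedinger w m W f x) \<in> L2 m" if "f \<in> L2 m"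
  proof -
    interpret A: gauged_operator "L2_le m" "\<lambda>x. 1 / sqrt (m x)" "schroedinger w m W" "2 * D + B"
      by (rule schroedinger_L2[OF W])
    show ?thesis using L2_le_imp(1)[OF Q_scale[OF A.Q_A[OF L2_le_norm[OF that]], of "-1"]] by simp
  qed
  show ?thesis
  proof
    assume R: "form_sum_op w m W f h"
    then have f: "f \<in> L2 m" by (auto simp: form_sum_op_def dom)
    have "h x = - schroedinger w m W f x" for x
    proof -
      let ?d = "\<lambda>y. if y = x then 1 else 0 :: real"
      have d: "?d \<in> L2 m" unfolding L2_def
        by (auto intro!: finite_nonzero_values_imp_summable_on)
      have val: "L2_inner m u ?d = m x * u x" for u
      proof -
        have "(\<Sum>\<^sub>\<infinity>y. m y * u y * ?d y) = (\<Sum>\<^sub>\<infinity>y\<in>{x}. m y * u y)"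
          by (rule infsum_cong_neutral) auto
        then show ?thesis by (simp add: L2_inner_def)
      qed
      have "form_sum w m W f ?d = L2_inner m h ?d"
        using R d by (auto simp: form_sum_op_def dom)
      then have "m x * (- schroedinger w m W f x) = m x * h x" unfolding form[OF f d] val .
      then show ?thesis using m_pos[of x] by (simp only: mult_cancel_left) simp
    qed
    with f show "f \<in> L2 m \<and> h = (\<lambda>x. - schroedinger w m W f x)" by auto
  qed (use form SL2 in \<open>auto simp: form_sum_op_def dom\<close>)
qed

text \<open>The series witnesses that the description by \<open>SOME\<close> is satisfiable, and every semigroup
  satisfying the description equals the series.\<close>

lemma L2_semigroup_eq:
  assumes W: "\<And>x. \<bar>W x\<bar> \<le> B" and t: "0 \<le> t" and f: "f \<in> L2 m"
  shows "L2_semigroup w m W t f x = op_exp (schroedinger w m W) t f x"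
proof -
  define P where "P T \<longleftrightarrow> C0_semigroup m T \<and>
        (\<forall>f h. generator m T f (\<lambda>x. - h x) \<longleftrightarrow> form_sum_op w m W f h)" for T
  note A = schroedinger_L2[OF W]
  have neg_swap: "(\<lambda>x. - h x) = u \<longleftrightarrow> h = (\<lambda>x. - u x)" for h u :: "'v \<Rightarrow> real" by auto
  have "P (op_exp (schroedinger w m W))"
    unfolding P_def
  proof (intro conjI allI C0_semigroup_op_exp[OF A])
    fix f h
    show "generator m (op_exp (schroedinger w m W)) f (\<lambda>x. - h x) \<longleftrightarrow> form_sum_op w m W f h"
      unfolding form_sum_op_iff[OF W] generator_op_exp_iff[OF A] by (simp only: neg_swap)
  qed
  then have "P (SOME T. P T)" by (rule someI[of P])
  then have "P (L2_semigroup w m W)" unfolding L2_semigroup_def P_def[abs_def] .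
  then have C0: "C0_semigroup m (L2_semigroup w m W)"
    and gen: "\<And>f h. generator m (L2_semigroup w m W) f (\<lambda>x. - h x) \<longleftrightarrow> form_sum_op w m W f h"
    unfolding P_def by simp_all
  show ?thesis
  proof (rule C0_semigroup_eq_op_exp[OF C0 A _ t f])
    fix u assume u: "u \<in> L2 m"
    have "generator m (L2_semigroup w m W) u (\<lambda>x. - (- schroedinger w m W u x))"
      unfolding gen form_sum_op_iff[OF W] using u by simp
    then show "((\<lambda>t. L2_norm m (\<lambda>x. (L2_semigroup w m W t u x - u x) / t - schroedinger w m W u x))
        \<longlongrightarrow> 0) (at_right 0)"
      by (simp add: generator_def)
  qed
qed

end

section \<open>The semigroup on bounded functions and comparison of subsolutions\<close>

definition sup_le :: "('v \<Rightarrow> real) \<Rightarrow> real \<Rightarrow> bool" where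
  "sup_le f C \<longleftrightarrow> (\<forall>x. \<bar>f x\<bar> \<le> C)"

lemma sup_leD: "sup_le f C \<Longrightarrow> \<bar>f x\<bar> \<le> C"
  by (simp add: sup_le_def)

lemma sup_le_nonneg: "sup_le f C \<Longrightarrow> 0 \<le> C"
  using sup_leD[of f C undefined] by linarith

lemma sup_le_mono: "sup_le f C \<Longrightarrow> C \<le> D \<Longrightarrow> sup_le f D"
  unfolding sup_le_def by (meson order_trans)

lemma sup_le_add: "sup_le f C \<Longrightarrow> sup_le g D \<Longrightarrow> sup_le (\<lambda>x. f x + g x) (C + D)"
  by (auto simp: sup_le_def intro!: order_trans[OF abs_triangle_ineq add_mono])

lemma sup_le_mult: "sup_le f C \<Longrightarrow> sup_le g D \<Longrightarrow> sup_le (\<lambda>x. f x * g x) (C * D)"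
  using sup_le_nonneg[of f C] by (auto simp: sup_le_def abs_mult intro!: mult_mono)

lemma sup_le_scale: "sup_le f C \<Longrightarrow> sup_le (\<lambda>x. a * f x) (\<bar>a\<bar> * C)"
  by (rule sup_le_mult) (simp add: sup_le_def)

interpretation sup: gauge sup_le "\<lambda>_. 1"
proof (unfold_locales, fact sup_le_nonneg, simp add: sup_leD, fact sup_le_mono, fact sup_le_add, fact sup_le_scale)
  fix F :: "nat \<Rightarrow> 'v \<Rightarrow> real" and f C
  assume F: "\<And>k. sup_le (F k) C" and lim: "\<And>x. (\<lambda>k. F k x) \<longlonglongrightarrow> f x"
  show "sup_le f C"
    unfolding sup_le_def
  proof
    fix x
    show "\<bar>f x\<bar> \<le> C"
      by (rule Lim_bounded[OF tendsto_rabs[OF lim], of 0]) (simp add: sup_leD[OF F])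
  qed
qed

context bounded_graph begin

abbreviation "H W \<equiv> schroedinger w m W"

lemma Gam_eq: "Gam w m f g x = (\<Sum>y | 0 < w x y. qrate w m x y * ((f y - f x) * (g y - g x))) / 2"
proof -
  have "Lap w m (\<lambda>y. f y * g y) x - f x * Lap w m g x - g x * Lap w m f x
      = (\<Sum>y | 0 < w x y. qrate w m x y * ((f y - f x) * (g y - g x)))"
    unfolding Lap_def sum_distrib_left sum_subtractf[symmetric]
    by (rule sum.cong) (auto simp: algebra_simps)
  then show ?thesis unfolding Gam_def by simp
qed

lemma Gam_nonneg: "0 \<le> Gam w m f f x"
  unfolding Gam_eq
  by (intro divide_nonneg_nonneg sum_nonneg mult_nonneg_nonneg[OF qrate_nonneg zero_le_square]) simp

lemma qrate_sum_le:
  assumes "\<And>y. a y \<le> C" "0 \<le> C"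
  shows "(\<Sum>y | 0 < w x y. qrate w m x y * a y) \<le> D * C"
proof -
  have "(\<Sum>y | 0 < w x y. qrate w m x y * a y) \<le> (\<Sum>y | 0 < w x y. qrate w m x y * C)"
    by (intro sum_mono mult_left_mono assms qrate_nonneg)
  also have "\<dots> = Deg w m x * C" by (simp add: Deg_def sum_distrib_right)
  also have "\<dots> \<le> D * C" by (intro mult_right_mono Deg_le assms)
  finally show ?thesis .
qed

lemma qrate_sum_abs_le:
  assumes "\<And>y. \<bar>a y\<bar> \<le> C"
  shows "\<bar>\<Sum>y | 0 < w x y. qrate w m x y * a y\<bar> \<le> D * C"
proof -
  have C: "0 \<le> C" using assms[of undefined] by linarith
  have "a y \<le> C" "- a y \<le> C" for y using assms[of y] by linarith+
  then show ?thesis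
    using qrate_sum_le[of a C x] qrate_sum_le[of "\<lambda>y. - a y" C x] C
    by (simp add: abs_le_iff sum_negf)
qed

lemma sup_le_diff: "sup_le f C \<Longrightarrow> \<bar>f y - f x\<bar> \<le> 2 * C"
  using sup_leD[of f C x] sup_leD[of f C y] by linarith

lemma Lap_sup_le: "sup_le f C \<Longrightarrow> sup_le (Lap w m f) (D * (2 * C))"
  unfolding sup_le_def[of "Lap w m f"] Lap_def by (intro allI qrate_sum_abs_le sup_le_diff)

lemma Gam_sup_le:
  assumes "sup_le f F" "sup_le g G" shows "sup_le (Gam w m f g) (D * (2 * F * (2 * G)))"
  unfolding sup_le_def
proof
  fix x
  have "\<bar>(f y - f x) * (g y - g x)\<bar> \<le> 2 * F * (2 * G)" for y
    unfolding abs_mult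
    by (intro mult_mono sup_le_diff assms) (use sup_le_nonneg[OF assms(1)] in auto)
  then have "\<bar>\<Sum>y | 0 < w x y. qrate w m x y * ((f y - f x) * (g y - g x))\<bar> \<le> D * (2 * F * (2 * G))"
    by (rule qrate_sum_abs_le)
  then show "\<bar>Gam w m f g x\<bar> \<le> D * (2 * F * (2 * G))" unfolding Gam_eq by simp
qed

lemma schroedinger_sup:
  assumes W: "sup_le W B"
  shows "gauged_operator sup_le (\<lambda>_. 1) (H W) (2 * D + B)"
proof
  show "locally_finite_op (H W)" by (rule locally_finite_schroedinger)
  show "0 \<le> 2 * D + B" using sup_le_nonneg[OF W] D_ge_1 by simp
  fix f :: "'v \<Rightarrow> real" and C assume f: "sup_le f C"
  have "sup_le (\<lambda>x. Lap w m f x + (-1) * (W x * f x)) (D * (2 * C) + \<bar>-1\<bar> * (B * C))"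
    by (intro sup_le_add sup_le_scale sup_le_mult Lap_sup_le f W)
  then show "sup_le (H W f) ((2 * D + B) * C)"
    by (simp add: schroedinger_def[abs_def] algebra_simps)
qed

text \<open>Differentiable in time at each vertex, with derivative \<open>u'\<close>, where \<open>u\<close> and \<open>u'\<close> are bounded uniformly over
  the vertices and over compact time intervals.\<close>

definition smooth_path :: "(real \<Rightarrow> 'v \<Rightarrow> real) \<Rightarrow> (real \<Rightarrow> 'v \<Rightarrow> real) \<Rightarrow> bool" where
  "smooth_path u u' \<longleftrightarrow> (\<forall>r y. ((\<lambda>r. u r y) has_real_derivative u' r y) (at r)) \<and>
     (\<forall>R. \<exists>C. \<forall>r. \<bar>r\<bar> \<le> R \<longrightarrow> sup_le (u r) C \<and> sup_le (u' r) C)"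

lemma smooth_pathD:
  assumes "smooth_path u u'"
  shows "((\<lambda>r. u r y) has_real_derivative u' r y) (at r)"
    and "\<exists>C. \<forall>r. \<bar>r\<bar> \<le> R \<longrightarrow> sup_le (u r) C \<and> sup_le (u' r) C"
  using assms unfolding smooth_path_def by blast+

lemma smooth_path_add:
  assumes u: "smooth_path u u'" and v: "smooth_path v v'"
  shows "smooth_path (\<lambda>r y. u r y + v r y) (\<lambda>r y. u' r y + v' r y)"
  unfolding smooth_path_def
proof (intro conjI allI)
  show "((\<lambda>r. u r y + v r y) has_real_derivative u' r y + v' r y) (at r)" for r y
    by (intro DERIV_add smooth_pathD(1) u v)
  fix R
  obtain C E where C: "\<And>r. \<bar>r\<bar> \<le> R \<Longrightarrow> sup_le (u r) C \<and> sup_le (u' r) C"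
    and E: "\<And>r. \<bar>r\<bar> \<le> R \<Longrightarrow> sup_le (v r) E \<and> sup_le (v' r) E"
    using smooth_pathD(2)[OF u, of R] smooth_pathD(2)[OF v, of R] by blast
  show "\<exists>C. \<forall>r. \<bar>r\<bar> \<le> R \<longrightarrow> sup_le (\<lambda>y. u r y + v r y) C \<and> sup_le (\<lambda>y. u' r y + v' r y) C"
    by (intro exI[of _ "C + E"] allI impI conjI sup_le_add) (use C E in auto)
qed

lemma smooth_path_mult:
  assumes u: "smooth_path u u'" and v: "smooth_path v v'"
  shows "smooth_path (\<lambda>r y. u r y * v r y) (\<lambda>r y. u' r y * v r y + u r y * v' r y)"
  unfolding smooth_path_def
proof (intro conjI allI)
  show "((\<lambda>r. u r y * v r y) has_real_derivative u' r y * v r y + u r y * v' r y) (at r)" for r y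
    using DERIV_mult[OF smooth_pathD(1)[OF u, of y r] smooth_pathD(1)[OF v, of y r]]
    by (simp add: algebra_simps)
  fix R
  obtain C E where C: "\<And>r. \<bar>r\<bar> \<le> R \<Longrightarrow> sup_le (u r) C \<and> sup_le (u' r) C"
    and E: "\<And>r. \<bar>r\<bar> \<le> R \<Longrightarrow> sup_le (v r) E \<and> sup_le (v' r) E"
    using smooth_pathD(2)[OF u, of R] smooth_pathD(2)[OF v, of R] by blast
  have "sup_le (\<lambda>y. u r y * v r y) (C * E + C * E) \<and>
      sup_le (\<lambda>y. u' r y * v r y + u r y * v' r y) (C * E + C * E)" if r: "\<bar>r\<bar> \<le> R" for r
  proof
    have p: "sup_le (\<lambda>y. u r y * v r y) (C * E)" by (intro sup_le_mult) (use C E r in auto)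
    show "sup_le (\<lambda>y. u r y * v r y) (C * E + C * E)"
      by (rule sup_le_mono[OF p]) (use sup_le_nonneg[OF p] in simp)
    show "sup_le (\<lambda>y. u' r y * v r y + u r y * v' r y) (C * E + C * E)"
      by (intro sup_le_add sup_le_mult) (use C E r in auto)
  qed
  then show "\<exists>C. \<forall>r. \<bar>r\<bar> \<le> R \<longrightarrow> sup_le (\<lambda>y. u r y * v r y) C \<and>
      sup_le (\<lambda>y. u' r y * v r y + u r y * v' r y) C" by blast
qed

lemma smooth_path_scalar:
  assumes a: "\<And>r. (a has_real_derivative a' r) (at r)" and a': "\<And>r. isCont a' r"
  shows "smooth_path (\<lambda>r _. a r) (\<lambda>r _. a' r)"
  unfolding smooth_path_def
proof (intro conjI allI)
  fix R :: real
  have "continuous_on {-R..R} a" "continuous_on {-R..R} a'"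
    using DERIV_isCont[OF a] a' by (simp_all add: continuous_at_imp_continuous_on)
  then have "bounded (a ` {-R..R})" "bounded (a' ` {-R..R})"
    by (auto intro!: compact_imp_bounded compact_continuous_image)
  then obtain C E where C: "\<And>r. r \<in> {-R..R} \<Longrightarrow> \<bar>a r\<bar> \<le> C" and E: "\<And>r. r \<in> {-R..R} \<Longrightarrow> \<bar>a' r\<bar> \<le> E"
    unfolding bounded_iff by (metis imageI real_norm_def)
  show "\<exists>C. \<forall>r. \<bar>r\<bar> \<le> R \<longrightarrow> sup_le (\<lambda>_. a r) C \<and> sup_le (\<lambda>_. a' r) C"
  proof (intro exI[of _ "max C E"] allI impI)
    fix r assume "\<bar>r\<bar> \<le> R"
    then have "r \<in> {-R..R}" by auto
    then show "sup_le (\<lambda>_. a r) (max C E) \<and> sup_le (\<lambda>_. a' r) (max C E)"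
      using C E by (simp add: sup_le_def le_max_iff_disj)
  qed
qed (rule a)

lemma smooth_path_Gam:
  assumes u: "smooth_path u u'"
  shows "smooth_path (\<lambda>r. Gam w m (u r) (u r)) (\<lambda>r y. 2 * Gam w m (u r) (u' r) y)"
  unfolding smooth_path_def
proof (intro conjI allI)
  show "((\<lambda>r. Gam w m (u r) (u r) y) has_real_derivative 2 * Gam w m (u r) (u' r) y) (at r)" for r y
  proof -
    have "((\<lambda>r. (\<Sum>z | 0 < w y z. qrate w m y z * ((u r z - u r y) * (u r z - u r y))) / 2) has_real_derivative
      (\<Sum>z | 0 < w y z. qrate w m y z *
         ((u' r z - u' r y) * (u r z - u r y) + (u' r z - u' r y) * (u r z - u r y))) / 2) (at r)"
      by (intro DERIV_cdivide DERIV_sum DERIV_cmult DERIV_mult DERIV_diff smooth_pathD(1)[OF u])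
    moreover have "(\<Sum>z | 0 < w y z. qrate w m y z *
         ((u' r z - u' r y) * (u r z - u r y) + (u' r z - u' r y) * (u r z - u r y))) / 2
         = 2 * Gam w m (u r) (u' r) y"
      unfolding Gam_eq times_divide_eq_right sum_distrib_left
      by (rule arg_cong[where f = "\<lambda>s. s / 2"], rule sum.cong) (auto simp: algebra_simps)
    ultimately show ?thesis unfolding Gam_eq by simp
  qed
  fix R
  obtain C where C: "\<And>r. \<bar>r\<bar> \<le> R \<Longrightarrow> sup_le (u r) C \<and> sup_le (u' r) C"
    using smooth_pathD(2)[OF u, of R] by blast
  have "sup_le (Gam w m (u r) (u r)) (2 * (D * (2 * C * (2 * C)))) \<and>
      sup_le (\<lambda>y. 2 * Gam w m (u r) (u' r) y) (2 * (D * (2 * C * (2 * C))))" if r: "\<bar>r\<bar> \<le> R" for r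
  proof
    have p: "sup_le (Gam w m (u r) (u r)) (D * (2 * C * (2 * C)))" by (intro Gam_sup_le) (use C r in auto)
    show "sup_le (Gam w m (u r) (u r)) (2 * (D * (2 * C * (2 * C))))"
      by (rule sup_le_mono[OF p]) (use sup_le_nonneg[OF p] in simp)
    show "sup_le (\<lambda>y. 2 * Gam w m (u r) (u' r) y) (2 * (D * (2 * C * (2 * C))))"
      using sup_le_scale[OF Gam_sup_le, of "u r" C "u' r" C 2] C[OF r] by simp
  qed
  then show "\<exists>C. \<forall>r. \<bar>r\<bar> \<le> R \<longrightarrow> sup_le (Gam w m (u r) (u r)) C \<and>
      sup_le (\<lambda>y. 2 * Gam w m (u r) (u' r) y) C" by blast
qed

lemma smooth_path_exp:
  assumes W: "sup_le W B" and f: "sup_le f C"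
  shows "smooth_path (\<lambda>r. op_exp (H W) r f) (\<lambda>r. H W (op_exp (H W) r f))"
  unfolding smooth_path_def
proof (intro conjI allI)
  interpret A: gauged_operator sup_le "\<lambda>_. 1" "H W" "2 * D + B" by (rule schroedinger_sup[OF W])
  show "((\<lambda>r. op_exp (H W) r f y) has_real_derivative H W (op_exp (H W) r f) y) (at r)" for r y
    by (rule A.exp_DERIV[OF f])
  fix R
  define E where "E = exp (R * (2 * D + B)) * C"
  have "sup_le (op_exp (H W) r f) (max E ((2 * D + B) * E)) \<and>
      sup_le (H W (op_exp (H W) r f)) (max E ((2 * D + B) * E))" if r: "\<bar>r\<bar> \<le> R" for r
  proof
    have p: "sup_le (op_exp (H W) r f) E" unfolding E_def by (rule A.Q_exp_le[OF f r])
    show "sup_le (op_exp (H W) r f) (max E ((2 * D + B) * E))" by (rule sup_le_mono[OF p]) simp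
    show "sup_le (H W (op_exp (H W) r f)) (max E ((2 * D + B) * E))"
      by (rule sup_le_mono[OF A.Q_A[OF p]]) simp
  qed
  then show "\<exists>C. \<forall>r. \<bar>r\<bar> \<le> R \<longrightarrow> sup_le (op_exp (H W) r f) C \<and> sup_le (H W (op_exp (H W) r f)) C"
    by blast
qed

text \<open>Duhamel's principle: along this path the defect \<open>(\<Delta> - W) u - u'\<close> is transported by the semigroup.\<close>

lemma duhamel_DERIV:
  assumes W: "sup_le W B" and u: "smooth_path u u'"
  shows "((\<lambda>s. op_exp (H W) s (u (t - s)) x) has_real_derivative
    op_exp (H W) s (\<lambda>y. H W (u (t - s)) y - u' (t - s) y) x) (at s)"
proof -
  interpret A: gauged_operator sup_le "\<lambda>_. 1" "H W" "2 * D + B" by (rule schroedinger_sup[OF W])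
  define R where "R = \<bar>s\<bar> + 1"
  obtain C where C: "\<And>r. \<bar>r\<bar> \<le> \<bar>t\<bar> + R \<Longrightarrow> sup_le (u r) C \<and> sup_le (u' r) C"
    using smooth_pathD(2)[OF u, of "\<bar>t\<bar> + R"] by blast
  have "((\<lambda>v. u (t - v) y) has_real_derivative - u' (t - v) y) (at v)" for v y
  proof -
    have "((\<lambda>v. t - v) has_real_derivative -1) (at v)" by (auto intro!: derivative_eq_intros)
    from DERIV_chain2[OF smooth_pathD(1)[OF u, of y "t - v"] this] show ?thesis by simp
  qed
  moreover have "sup_le (u (t - v)) C" "sup_le (\<lambda>y. - u' (t - v) y) C" if "\<bar>v\<bar> \<le> R" for v
  proof -
    have "\<bar>t - v\<bar> \<le> \<bar>t\<bar> + R" using that by linarith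
    from C[OF this] show "sup_le (u (t - v)) C" "sup_le (\<lambda>y. - u' (t - v) y) C"
      by (auto simp: sup_le_def)
  qed
  ultimately have "((\<lambda>s. op_exp (H W) s (u (t - s)) x) has_real_derivative
    op_exp (H W) s (\<lambda>y. H W (u (t - s)) y + - u' (t - s) y) x) (at s)"
    by (intro A.exp_path_DERIV[where R = R and H = C]) (auto simp: R_def)
  then show ?thesis by simp
qed

lemma exp_unique_solution:
  assumes W: "sup_le W B" and u: "smooth_path u (\<lambda>r. H W (u r))"
  shows "op_exp (H W) t (u 0) x = u t x"
proof -
  interpret A: gauged_operator sup_le "\<lambda>_. 1" "H W" "2 * D + B" by (rule schroedinger_sup[OF W])
  have "sup_le (\<lambda>_ :: 'v. 0) 0" by (simp add: sup_le_def)
  then have "op_exp (H W) s (\<lambda>_. 0) x = 0" for s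
    using A.exp_scale[of "\<lambda>_. 0" 0 s 0 x] by simp
  then have "((\<lambda>s. op_exp (H W) s (u (t - s)) x) has_real_derivative 0) (at s)" for s
    using duhamel_DERIV[OF W u, of t x s] by simp
  then have "op_exp (H W) t (u (t - t)) x = op_exp (H W) 0 (u (t - 0)) x"
    using DERIV_isconst_all by blast
  then show ?thesis by simp
qed

text \<open>Both sides solve the same linear evolution equation with the same initial value.\<close>

lemma exp_shift_potential:
  assumes W: "sup_le W B" and f: "sup_le f C"
  shows "op_exp (H (\<lambda>x. W x - b)) t f x = exp (b * t) * op_exp (H W) t f x"
proof -
  have W': "sup_le (\<lambda>x. W x - b) (B + \<bar>b\<bar>)"
    using sup_le_add[OF W, of "\<lambda>_. - b" "\<bar>b\<bar>"] by (simp add: sup_le_def)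
  have "smooth_path (\<lambda>r _. exp (b * r)) (\<lambda>r _. b * exp (b * r))"
    by (rule smooth_path_scalar) (auto intro!: derivative_eq_intros continuous_intros)
  note path = smooth_path_mult[OF this smooth_path_exp[OF W f]]
  have "H (\<lambda>x. W x - b) (\<lambda>y. a * g y) x = b * a * g x + a * H W g x" for a g x
    unfolding locally_finite_op_scale[OF locally_finite_schroedinger]
    by (simp add: schroedinger_def algebra_simps)
  then have "smooth_path (\<lambda>r y. exp (b * r) * op_exp (H W) r f y)
     (\<lambda>r. H (\<lambda>x. W x - b) (\<lambda>y. exp (b * r) * op_exp (H W) r f y))"
    using path by presburger
  from exp_unique_solution[OF W' this, of t x] show ?thesis by simp
qed

text \<open>After subtracting \<open>b = B + D\<close> from the potential, \<open>\<Delta> - W + b\<close> has a nonnegative kernel, so every term of its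
  series is nonnegative.\<close>

lemma exp_nonneg:
  assumes W: "sup_le W B" and f: "sup_le f C" "\<And>x. 0 \<le> f x" and t: "0 \<le> t"
  shows "0 \<le> op_exp (H W) t f x"
proof -
  define b where "b = B + D"
  have W': "sup_le (\<lambda>x. W x - b) (B + \<bar>b\<bar>)"
    using sup_le_add[OF W, of "\<lambda>_. - b" "\<bar>b\<bar>"] by (simp add: sup_le_def)
  interpret A: gauged_operator sup_le "\<lambda>_. 1" "H (\<lambda>x. W x - b)" "2 * D + (B + \<bar>b\<bar>)"
    by (rule schroedinger_sup[OF W'])
  have pos: "0 \<le> H (\<lambda>x. W x - b) g x" if g: "\<And>x. 0 \<le> g x" for g x
  proof -
    have "H (\<lambda>x. W x - b) g x
        = (\<Sum>y | 0 < w x y. qrate w m x y * g y) + (b - W x - Deg w m x) * g x"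
      by (simp add: schroedinger_def Lap_eq algebra_simps)
    moreover have "0 \<le> b - W x - Deg w m x" using sup_leD[OF W, of x] Deg_le[of x] by (simp add: b_def)
    ultimately show ?thesis using g qrate_nonneg by (simp add: sum_nonneg)
  qed
  have "0 \<le> (H (\<lambda>x. W x - b) ^^ k) f x" for k x
    by (induction k arbitrary: x) (use f pos in auto)
  then have "0 \<le> op_exp (H (\<lambda>x. W x - b)) t f x"
    unfolding op_exp_def using t by (intro suminf_nonneg A.term_summable[OF f(1)]) simp
  then show ?thesis unfolding exp_shift_potential[OF W f(1)] by (simp add: zero_le_mult_iff)
qed

text \<open>By Duhamel's principle the derivative of \<open>s \<mapsto> e\<^bsup>s(\<Delta>-W)\<^esup> u\<^bsub>t-s\<^esub>\<close> is the semigroup applied to the nonnegative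
  function \<open>(\<Delta> - W) u - u'\<close>, hence nonnegative.\<close>

lemma subsolution_le_exp:
  assumes W: "sup_le W B" and u: "smooth_path u u'" and t: "0 \<le> t"
    and sub: "\<And>r y. 0 \<le> r \<Longrightarrow> u' r y \<le> H W (u r) y"
  shows "u t x \<le> op_exp (H W) t (u 0) x"
proof -
  interpret A: gauged_operator sup_le "\<lambda>_. 1" "H W" "2 * D + B" by (rule schroedinger_sup[OF W])
  have "(\<lambda>s. op_exp (H W) s (u (t - s)) x) 0 \<le> (\<lambda>s. op_exp (H W) s (u (t - s)) x) t"
  proof (rule DERIV_nonneg_imp_nondecreasing[OF t])
    fix s assume s: "0 \<le> s" "s \<le> t"
    obtain C where C: "sup_le (u (t - s)) C" "sup_le (u' (t - s)) C"
      using smooth_pathD(2)[OF u, of "\<bar>t - s\<bar>"] by blast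
    have "sup_le (\<lambda>y. H W (u (t - s)) y + (-1) * u' (t - s) y) ((2 * D + B) * C + \<bar>-1\<bar> * C)"
      by (intro sup_le_add sup_le_scale A.Q_A C)
    then have "0 \<le> op_exp (H W) s (\<lambda>y. H W (u (t - s)) y - u' (t - s) y) x"
      using sub[of "t - s"] s by (intro exp_nonneg[OF W, of _ "(2 * D + B) * C + C"]) auto
    then show "\<exists>y. ((\<lambda>s. op_exp (H W) s (u (t - s)) x) has_real_derivative y) (at s) \<and> 0 \<le> y"
      using duhamel_DERIV[OF W u] by blast
  qed
  then show ?thesis by simp
qed

text \<open>For \<open>W \<le> W'\<close> a nonnegative solution for \<open>W'\<close> is a subsolution for \<open>W\<close>.\<close>

lemma exp_antimono_potential:
  assumes W: "sup_le W B" and W': "sup_le W' B'" and le: "\<And>x. W x \<le> W' x"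
    and f: "sup_le f C" "\<And>x. 0 \<le> f x" and t: "0 \<le> t"
  shows "op_exp (H W') t f x \<le> op_exp (H W) t f x"
  using subsolution_le_exp[OF W smooth_path_exp[OF W' f(1)] t, of x]
    mult_right_mono[OF le exp_nonneg[OF W' f]]
  by (simp add: schroedinger_def)

section \<open>Extension to bounded functions by monotone approximation\<close>

text \<open>Positivity gives the upper bound. For the lower bound, \<open>f\<close> is cut off to the first \<open>n\<close> vertices of an
  enumeration, and dominated convergence of the series (Tannery's theorem) applies.\<close>

lemma semigroup_mono_eq:
  assumes W: "sup_le W B" and f: "sup_le f C" "\<And>x. 0 \<le> f x" and t: "0 \<le> t"
  shows "semigroup_mono w m W t f x = ereal (op_exp (H W) t f x)"
proof -
  interpret A: gauged_operator sup_le "\<lambda>_. 1" "H W" "2 * D + B" by (rule schroedinger_sup[OF W])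
  define G where "G = {g. finite {y. g y \<noteq> 0} \<and> (\<forall>y. 0 \<le> g y \<and> g y \<le> f y)}"
  have L2G: "L2_semigroup w m W t g x = op_exp (H W) t g x" if "g \<in> G" for g
  proof (rule L2_semigroup_eq[OF sup_leD[OF W] t])
    have "finite {y. g y \<noteq> 0}" using that by (simp add: G_def)
    then have "finite {y \<in> UNIV. m y * (g y)\<^sup>2 \<noteq> 0}" by (rule rev_finite_subset) auto
    then show "g \<in> L2 m" unfolding L2_def by (auto intro: finite_nonzero_values_imp_summable_on)
  qed
  have Gb: "sup_le g C" if "g \<in> G" for g
    unfolding sup_le_def
  proof
    fix y
    have "0 \<le> g y" "g y \<le> f y" using that by (auto simp: G_def)
    then show "\<bar>g y\<bar> \<le> C" using sup_leD[OF f(1), of y] by simp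
  qed
  have upper: "op_exp (H W) t g x \<le> op_exp (H W) t f x" if g: "g \<in> G" for g
  proof -
    have "sup_le (\<lambda>y. 1 * f y + (-1) * g y) (\<bar>1\<bar> * C + \<bar>-1\<bar> * C)"
      by (intro sup_le_add sup_le_scale f Gb g)
    then have "0 \<le> op_exp (H W) t (\<lambda>y. 1 * f y + (-1) * g y) x"
      by (rule exp_nonneg[OF W _ _ t]) (use g in \<open>auto simp: G_def\<close>)
    then show ?thesis unfolding A.exp_lincomb[OF f(1) Gb[OF g]] by simp
  qed
  \<comment> \<open>Countability enters here: these cutoffs are finitely supported and exhaust \<open>f\<close>.\<close>
  define F where "F n y = (if to_nat y < n then f y else 0)" for n :: nat and y
  have FG: "F n \<in> G" for n
  proof -
    have "finite (to_nat -` {..<n} :: 'v set)" by (rule finite_vimageI) (auto intro: inj_to_nat)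
    then have "finite {y. F n y \<noteq> 0}" by (rule rev_finite_subset) (auto simp: F_def)
    then show ?thesis using f(2) by (auto simp: G_def F_def)
  qed
  have Flim: "(\<lambda>n. F n y) \<longlonglongrightarrow> f y" for y
    by (rule tendsto_eventually, rule eventually_sequentiallyI[of "Suc (to_nat y)"]) (simp add: F_def)
  have conv: "(\<lambda>n. op_exp (H W) t (F n) x) \<longlonglongrightarrow> op_exp (H W) t f x"
  proof -
    have lim: "(\<lambda>n. t ^ k / fact k * (H W ^^ k) (F n) x) \<longlonglongrightarrow> t ^ k / fact k * (H W ^^ k) f x" for k
      by (intro tendsto_mult tendsto_const
          locally_finite_op_tendsto[OF locally_finite_op_power[OF A.A] Flim])
    have bd: "\<bar>t ^ k / fact k * (H W ^^ k) (F n) x\<bar> \<le> \<bar>t\<bar> ^ k / fact k * (C * (2 * D + B) ^ k)" for k n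
      using sup_leD[OF A.Q_term[OF Gb[OF FG]]] .
    have "eventually (\<lambda>(k, n). norm (t ^ k / fact k * (H W ^^ k) (F n) x)
        \<le> \<bar>t\<bar> ^ k / fact k * (C * (2 * D + B) ^ k)) (at_top \<times>\<^sub>F sequentially)"
      by (rule always_eventually) (use bd in auto)
    from tannerys_theorem[OF lim this summable_exp_real sequentially_bot]
    show ?thesis unfolding op_exp_def by blast
  qed
  show ?thesis
    unfolding semigroup_mono_def G_def[symmetric]
  proof (rule antisym)
    show "(SUP g\<in>G. ereal (L2_semigroup w m W t g x)) \<le> ereal (op_exp (H W) t f x)"
      by (rule SUP_least) (simp add: L2G upper)
    show "ereal (op_exp (H W) t f x) \<le> (SUP g\<in>G. ereal (L2_semigroup w m W t g x))"
    proof (rule tendsto_upperbound[OF tendsto_ereal[OF conv]])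
      show "\<forall>\<^sub>F n in sequentially. ereal (op_exp (H W) t (F n) x)
          \<le> (SUP g\<in>G. ereal (L2_semigroup w m W t g x))"
      proof (rule always_eventually, rule allI)
        fix n
        show "ereal (op_exp (H W) t (F n) x) \<le> (SUP g\<in>G. ereal (L2_semigroup w m W t g x))"
          by (rule SUP_upper2[OF FG[of n]]) (simp add: L2G[OF FG])
      qed
    qed simp
  qed
qed

text \<open>If \<open>W\<close> is unbounded below, the truncations \<open>max W (- j)\<close> eventually lie below \<open>W'\<close>, and their
  semigroups increase with \<open>j\<close>.\<close>

lemma exp_le_semigroup_pot:
  assumes W': "sup_le W' B" and le: "\<And>x. W x \<le> W' x"
    and f: "sup_le f C" "\<And>x. 0 \<le> f x" and t: "0 \<le> t"
  shows "ereal (op_exp (H W') t f x) \<le> semigroup_pot w m W t f x"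
proof (cases "bdd_below (range W)")
  case True
  then obtain b where b: "\<And>x. b \<le> W x" by (auto simp: bdd_below_def)
  have W: "sup_le W (max \<bar>b\<bar> B)"
    unfolding sup_le_def
  proof
    fix x
    show "\<bar>W x\<bar> \<le> max \<bar>b\<bar> B" using b[of x] le[of x] sup_leD[OF W', of x] by linarith
  qed
  show ?thesis
    using True semigroup_mono_eq[OF W f t] exp_antimono_potential[OF W W' le f t]
    by (simp add: semigroup_pot_def)
next
  case False
  define V where "V j y = max (W y) (- real j)" for j y
  have V: "sup_le (V j) (max (real j) B)" for j
    unfolding sup_le_def
  proof
    fix x
    show "\<bar>V j x\<bar> \<le> max (real j) B"
      using le[of x] sup_leD[OF W', of x] by (simp add: V_def max_def abs_le_iff)
  qed
  define X where "X j = semigroup_mono w m (V j) t f x" for j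
  have X: "X j = ereal (op_exp (H (V j)) t f x)" for j
    unfolding X_def by (rule semigroup_mono_eq[OF V f t])
  have "incseq X"
    unfolding X by (intro incseq_SucI ereal_less_eq(3)[THEN iffD2]
        exp_antimono_potential[OF V V _ f t]) (simp add: V_def)
  then have "lim X = (SUP j. X j)" by (intro limI LIMSEQ_SUP)
  then have pot: "semigroup_pot w m W t f x = (SUP j. X j)"
    using False by (simp add: semigroup_pot_def X_def[abs_def] V_def[abs_def])
  obtain j :: nat where j: "B \<le> real j" using real_arch_simple by blast
  have "op_exp (H W') t f x \<le> op_exp (H (V j)) t f x"
  proof (rule exp_antimono_potential[OF V W' _ f t])
    fix x
    show "V j x \<le> W' x" using le[of x] sup_leD[OF W', of x] j by (simp add: V_def)
  qed
  then show ?thesis unfolding pot by (intro SUP_upper2[of j]) (simp_all add: X)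
qed

lemma schroedinger_zero: "H (\<lambda>_. 0) = Lap w m"
  by (simp add: schroedinger_def fun_eq_iff)

lemma zero_potential: "sup_le (\<lambda>_. 0) 0"
  by (simp add: sup_le_def)

lemma heat_eq:
  assumes f: "sup_le f C" and t: "0 \<le> t"
  shows "heat w m t f = op_exp (Lap w m) t f"
proof
  fix x
  interpret A: gauged_operator sup_le "\<lambda>_. 1" "H (\<lambda>_. 0)" "2 * D + 0"
    by (rule schroedinger_sup[OF zero_potential])
  have pm: "sup_le (\<lambda>y. max (f y) 0) C" "sup_le (\<lambda>y. max (- f y) 0) C"
    using f sup_le_nonneg[OF f] by (auto simp: sup_le_def abs_le_iff)
  have "semigroup_pot w m (\<lambda>_. 0) t g x = ereal (op_exp (H (\<lambda>_. 0)) t g x)"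
    if "sup_le g C" "\<And>y. 0 \<le> g y" for g
    using semigroup_mono_eq[OF zero_potential that t] by (simp add: semigroup_pot_def)
  then have "heat w m t f x = op_exp (H (\<lambda>_. 0)) t (\<lambda>y. max (f y) 0) x
      - op_exp (H (\<lambda>_. 0)) t (\<lambda>y. max (- f y) 0) x"
    using pm by (simp add: heat_def)
  also have "\<dots> = op_exp (H (\<lambda>_. 0)) t (\<lambda>y. 1 * max (f y) 0 + (-1) * max (- f y) 0) x"
    unfolding A.exp_lincomb[OF pm] by simp
  also have "(\<lambda>y. 1 * max (f y) 0 + (-1) * max (- f y) 0) = f"
    by (auto simp: fun_eq_iff max_def)
  finally show "heat w m t f x = op_exp (Lap w m) t f x" unfolding schroedinger_zero .
qed

section \<open>The range of the curvature function\<close>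

definition curvature_ge :: "('v \<Rightarrow> real) \<Rightarrow> bool" where
  "curvature_ge \<sigma> \<longleftrightarrow> (\<forall>f C. sup_le f C \<longrightarrow> (\<forall>x. \<sigma> x * Gam w m f f x \<le> Gam2 w m f f x))"

text \<open>The dimension term \<open>(\<Delta>f)\<^sup>2 / n\<close> is nonnegative.\<close>

lemma CD_imp_curvature_ge:
  assumes "CD w m \<rho> n" "0 < n" shows "curvature_ge \<rho>"
  unfolding curvature_ge_def
proof (intro allI impI)
  fix f :: "'v \<Rightarrow> real" and C x assume "sup_le f C"
  then have "bounded (range f)" unfolding bounded_iff sup_le_def by auto
  then have "\<rho> x * Gam w m f f x + real_of_ereal (1 / n) * (Lap w m f x)\<^sup>2 \<le> Gam2 w m f f x"
    using assms(1) unfolding CD_def by blast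
  moreover have "0 \<le> real_of_ereal (1 / n)" using assms(2) unfolding one_ereal_def by (cases n) auto
  then have "0 \<le> real_of_ereal (1 / n) * (Lap w m f x)\<^sup>2" by simp
  ultimately show "\<rho> x * Gam w m f f x \<le> Gam2 w m f f x" by linarith
qed

text \<open>The only unfavourable term is \<open>\<Gamma>(f, \<Delta>f)(x)\<close>. With \<open>a\<^sub>y = f(y) - f(x)\<close>, the bound
  \<open>(\<Delta>f(y))\<^sup>2 \<le> 2 D \<Gamma>f(y)\<close> and Young's inequality give \<open>a\<^sub>y \<Delta>f(y) \<le> D a\<^sub>y\<^sup>2 / 2 + \<Gamma>f(y)\<close>, and the sum of the
  terms \<open>q(x,y) \<Gamma>f(y)\<close> is compensated by \<open>\<Delta>\<Gamma>f(x)\<close>.\<close>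

lemma Gam2_ge: "- D * Gam w m f f x \<le> Gam2 w m f f x"
proof -
  let ?G = "Gam w m f f" and ?L = "Lap w m f"
  let ?S = "\<lambda>a. \<Sum>y | 0 < w x y. qrate w m x y * a y"
  define a where "a y = f y - f x" for y
  have G: "?S (\<lambda>y. (a y)\<^sup>2) = 2 * ?G x" by (simp add: Gam_eq a_def power2_eq_square)
  have "Deg w m x * ?G x \<le> D * ?G x" by (intro mult_right_mono Deg_le Gam_nonneg)
  then have LG: "?S ?G - D * ?G x \<le> Lap w m ?G x" by (simp add: Lap_eq)
  have cross: "a y * ?L y \<le> D / 2 * (a y)\<^sup>2 + ?G y" for y
  proof -
    have "(?L y)\<^sup>2 \<le> Deg w m y * (\<Sum>z | 0 < w y z. qrate w m y z * (f z - f y)\<^sup>2)"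
      unfolding Lap_def by (rule weighted_Cauchy_Schwarz)
    also have "\<dots> = Deg w m y * (2 * ?G y)" by (simp add: Gam_eq power2_eq_square)
    also have "\<dots> \<le> D * (2 * ?G y)" by (intro mult_right_mono Deg_le) (simp add: Gam_nonneg)
    finally have L: "(?L y)\<^sup>2 \<le> D * (2 * ?G y)" .
    have "2 * D * (a y * ?L y) \<le> (D * a y)\<^sup>2 + (?L y)\<^sup>2"
      using zero_le_power2[of "D * a y - ?L y"] unfolding power2_diff by simp
    also have "\<dots> \<le> (D * a y)\<^sup>2 + D * (2 * ?G y)" using L by simp
    also have "\<dots> = 2 * D * (D / 2 * (a y)\<^sup>2 + ?G y)"
      by (simp add: power_mult_distrib power2_eq_square distrib_left)
    finally show ?thesis by (rule mult_left_le_imp_le) (use D_ge_1 in simp)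
  qed
  have expand: "2 * Gam w m f ?L x = ?S (\<lambda>y. a y * ?L y) - ?L x * ?S a"
  proof -
    have "2 * Gam w m f ?L x = ?S (\<lambda>y. a y * (?L y - ?L x))" by (simp add: Gam_eq a_def)
    also have "\<dots> = (\<Sum>y | 0 < w x y. qrate w m x y * (a y * ?L y) - ?L x * (qrate w m x y * a y))"
      by (rule sum.cong) (auto simp: algebra_simps)
    finally show ?thesis by (simp only: sum_subtractf sum_distrib_left)
  qed
  have square: "?L x * ?S a = (?L x)\<^sup>2" by (simp add: Lap_def a_def power2_eq_square)
  have bound: "?S (\<lambda>y. a y * ?L y) \<le> ?S (\<lambda>y. D / 2 * (a y)\<^sup>2 + ?G y)"
    by (intro sum_mono mult_left_mono qrate_nonneg cross)
  have split: "?S (\<lambda>y. D / 2 * (a y)\<^sup>2 + ?G y) = D / 2 * ?S (\<lambda>y. (a y)\<^sup>2) + ?S ?G"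
  proof -
    have "?S (\<lambda>y. D / 2 * (a y)\<^sup>2 + ?G y)
        = (\<Sum>y | 0 < w x y. D / 2 * (qrate w m x y * (a y)\<^sup>2) + qrate w m x y * ?G y)"
      by (rule sum.cong) (auto simp: algebra_simps)
    then show ?thesis by (simp only: sum.distrib sum_distrib_left)
  qed
  have "2 * Gam w m f ?L x \<le> D * ?G x + ?S ?G"
    using bound zero_le_power2[of "?L x"] unfolding expand square split G by linarith
  then show ?thesis using LG by (simp add: Gam2_def)
qed

text \<open>Where the truncation is active, the universal bound \<open>\<Gamma>\<^sub>2 f \<ge> - D \<Gamma> f\<close> takes over.\<close>

lemma curvature_ge_truncate:
  assumes "curvature_ge \<rho>" "\<And>x. \<sigma> x \<le> \<rho> x" "D \<le> c"
  shows "curvature_ge (\<lambda>x. max (\<sigma> x) (- c))"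
  unfolding curvature_ge_def
proof (intro allI impI)
  fix f :: "'v \<Rightarrow> real" and C x assume f: "sup_le f C"
  show "max (\<sigma> x) (- c) * Gam w m f f x \<le> Gam2 w m f f x"
  proof (cases "\<sigma> x \<le> - c")
    case True
    then have "max (\<sigma> x) (- c) * Gam w m f f x \<le> - D * Gam w m f f x"
      using assms(3) by (intro mult_right_mono Gam_nonneg) simp
    then show ?thesis using Gam2_ge[of f x] by linarith
  next
    case False
    then have "max (\<sigma> x) (- c) * Gam w m f f x \<le> \<rho> x * Gam w m f f x"
      using assms(2)[of x] by (intro mult_right_mono Gam_nonneg) simp
    also have "\<dots> \<le> Gam2 w m f f x" using assms(1) f unfolding curvature_ge_def by blast
    finally show ?thesis .
  qed
qed

text \<open>Tested with the indicator of \<open>x\<close>, the curvature bound reads \<open>\<rho>(x) \<Gamma>f(x) \<le> \<Gamma>\<^sub>2f(x) \<le> 3 D \<Gamma>f(x)\<close>, where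
  \<open>\<Gamma>f(x)\<close> is half the degree of \<open>x\<close>. If some degree is zero, then by connectedness the graph has only one
  vertex.\<close>

lemma curvature_bounded_above:
  assumes "curvature_ge \<rho>" shows "\<exists>C. \<forall>x. \<rho> x \<le> C"
proof (cases "\<exists>x. {y. 0 < w x y} = {}")
  case True
  then obtain x where x: "\<And>y. \<not> 0 < w x y" by blast
  have all: "y = x" for y
  proof -
    have "(x, y) \<in> {(a, b). 0 < w a b}\<^sup>*" using mwg unfolding mwg_def by blast
    then show ?thesis by (rule converse_rtranclE) (use x in auto)
  qed
  have "\<rho> y \<le> \<rho> x" for y using all[of y] by simp
  then show ?thesis by blast
next
  case False
  have "\<rho> x \<le> 3 * D" for x
  proof -
    define f where "f y = (if y = x then 1 else 0 :: real)" for y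
    let ?G = "Gam w m f f" and ?L = "Lap w m f"
    have f: "sup_le f 1" by (simp add: sup_le_def f_def)
    have df: "\<bar>f z - f y\<bar> \<le> 1" for y z by (simp add: f_def)
    have "(f y - f x) * (f y - f x) = 1" if "0 < w x y" for y
      using that w_diag[of x] by (auto simp: f_def)
    then have Gx: "?G x = Deg w m x / 2" by (simp add: Gam_eq Deg_def)
    obtain y where "0 < w x y" using False by blast
    then have "0 < qrate w m x y" using m_pos[of x] by (simp add: qrate_def)
    then have "0 < Deg w m x" unfolding Deg_def
      using nbhd_finite \<open>0 < w x y\<close> by (intro sum_pos2[of _ y]) (auto simp: qrate_nonneg)
    with Gx have Gpos: "0 < ?G x" by simp
    have Gy: "?G y \<le> D / 2" for y
    proof -
      have "(f z - f y) * (f z - f y) \<le> 1" for z by (simp add: f_def)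
      from qrate_sum_le[of "\<lambda>z. (f z - f y) * (f z - f y)" 1 y, OF this]
      show ?thesis by (simp add: Gam_eq)
    qed
    have Ly: "\<bar>?L y\<bar> \<le> D" for y
      using qrate_sum_abs_le[of "\<lambda>z. f z - f y" 1 y, OF df] by (simp add: Lap_def)
    have "Lap w m ?G x \<le> (\<Sum>y | 0 < w x y. qrate w m x y * (D / 2))"
    proof -
      have "(\<Sum>y | 0 < w x y. qrate w m x y * ?G y) \<le> (\<Sum>y | 0 < w x y. qrate w m x y * (D / 2))"
        by (intro sum_mono mult_left_mono Gy qrate_nonneg)
      moreover have "0 \<le> Deg w m x * ?G x" by (intro mult_nonneg_nonneg Deg_nonneg Gam_nonneg)
      ultimately show ?thesis by (simp add: Lap_eq)
    qed
    also have "\<dots> = D * ?G x" unfolding Gx Deg_def sum_distrib_right[symmetric] by simp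
    finally have 1: "Lap w m ?G x \<le> D * ?G x" .
    have "(\<Sum>y | 0 < w x y. qrate w m x y * - ((f y - f x) * (?L y - ?L x)))
        \<le> (\<Sum>y | 0 < w x y. qrate w m x y * (2 * D))"
    proof (intro sum_mono mult_left_mono qrate_nonneg)
      fix y
      have "- ((f y - f x) * (?L y - ?L x)) \<le> \<bar>f y - f x\<bar> * \<bar>?L y - ?L x\<bar>"
        unfolding abs_mult[symmetric] by simp
      also have "\<dots> \<le> 1 * (2 * D)"
        using df[of y x] Ly[of x] Ly[of y] by (intro mult_mono) auto
      finally show "- ((f y - f x) * (?L y - ?L x)) \<le> 2 * D" by simp
    qed
    also have "\<dots> = 4 * D * ?G x" unfolding Gx Deg_def sum_distrib_right[symmetric] by simp
    finally have 2: "- (2 * Gam w m f ?L x) \<le> 4 * D * ?G x" by (simp add: Gam_eq sum_negf)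
    have "Gam2 w m f f x \<le> 3 * D * ?G x"
    proof -
      have "0 \<le> D * ?G x" using D_ge_1 Gpos by simp
      moreover have "(l - g - g) / 2 \<le> 3 * p" if "0 \<le> p" "l \<le> p" "- (2 * g) \<le> 4 * p"
        for l g p :: real using that by argo
      ultimately show ?thesis using 1 2 unfolding Gam2_def mult.assoc by blast
    qed
    moreover have "\<rho> x * ?G x \<le> Gam2 w m f f x" using assms f unfolding curvature_ge_def by blast
    ultimately have "\<rho> x * ?G x \<le> 3 * D * ?G x" by linarith
    then show ?thesis using Gpos by simp
  qed
  then show ?thesis by blast
qed

section \<open>Gradient estimates\<close>

text \<open>The curvature bound says that \<open>r \<mapsto> \<Gamma> P\<^sub>r f\<close> is a subsolution for the potential \<open>2 \<rho>\<close>.\<close>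

lemma gradient_estimate:
  assumes curv: "curvature_ge \<rho>" and \<rho>: "sup_le \<rho> B" and f: "sup_le f C" and t: "0 \<le> t"
  shows "Gam w m (op_exp (Lap w m) t f) (op_exp (Lap w m) t f) x
    \<le> op_exp (H (\<lambda>y. 2 * \<rho> y)) t (Gam w m f f) x"
proof -
  let ?P = "\<lambda>r. op_exp (Lap w m) r f"
  have P: "smooth_path ?P (\<lambda>r. Lap w m (?P r))"
    using smooth_path_exp[OF zero_potential f] unfolding schroedinger_zero .
  have "Gam w m (?P t) (?P t) x \<le> op_exp (H (\<lambda>y. 2 * \<rho> y)) t (Gam w m (?P 0) (?P 0)) x"
  proof (rule subsolution_le_exp[OF sup_le_scale[OF \<rho>] smooth_path_Gam[OF P] t])
    fix r y
    obtain C' where "sup_le (?P r) C'" using smooth_pathD(2)[OF P, of "\<bar>r\<bar>"] by blast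
    then have "\<rho> y * Gam w m (?P r) (?P r) y \<le> Gam2 w m (?P r) (?P r) y"
      using curv unfolding curvature_ge_def by blast
    then show "2 * Gam w m (?P r) (Lap w m (?P r)) y
        \<le> H (\<lambda>y. 2 * \<rho> y) (Gam w m (?P r) (?P r)) y"
      by (simp add: schroedinger_def Gam2_def)
  qed
  then show ?thesis by simp
qed

text \<open>The equation \<open>E' = 1 + 2 K E\<close> is what makes the terms with \<open>\<Gamma> P\<^sub>r f\<close> cancel: \<open>\<Delta> (P\<^sub>r f)\<^sup>2\<close> contributes
  \<open>2 \<Gamma>\<close>, the shift of the potential by \<open>- 2 K\<close> contributes \<open>4 K E \<Gamma>\<close>, and the derivative of \<open>E\<close> removes
  \<open>2 E' \<Gamma>\<close>.\<close>

lemma reverse_poincare: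
  assumes curv: "curvature_ge \<rho>" and \<rho>: "sup_le \<rho> B" and K: "\<And>x. \<rho> x \<le> K"
    and E: "\<And>r. (E has_real_derivative 1 + 2 * K * E r) (at r)" "E 0 = 0" "\<And>r. 0 \<le> r \<Longrightarrow> 0 \<le> E r"
    and f: "sup_le f C" and t: "0 \<le> t"
  shows "2 * E t * Gam w m (op_exp (Lap w m) t f) (op_exp (Lap w m) t f) x
    \<le> exp (2 * K * t) * op_exp (H (\<lambda>y. 2 * \<rho> y)) t (\<lambda>y. (f y)\<^sup>2) x - (op_exp (Lap w m) t f x)\<^sup>2"
proof -
  let ?P = "\<lambda>r. op_exp (Lap w m) r f"
  let ?W = "\<lambda>y. 2 * \<rho> y - 2 * K"
  have P: "smooth_path ?P (\<lambda>r. Lap w m (?P r))"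
    using smooth_path_exp[OF zero_potential f] unfolding schroedinger_zero .
  have "isCont (\<lambda>r. 1 + 2 * K * E r) r" for r
    by (intro continuous_intros DERIV_isCont[OF E(1)])
  note Epath = smooth_path_scalar[OF E(1) this]
  define u where "u r y = ?P r y * ?P r y + E r * (2 * Gam w m (?P r) (?P r) y)" for r y
  define u' where "u' r y = Lap w m (?P r) y * ?P r y + ?P r y * Lap w m (?P r) y
     + ((1 + 2 * K * E r) * (2 * Gam w m (?P r) (?P r) y)
        + E r * (2 * (2 * Gam w m (?P r) (Lap w m (?P r)) y)))" for r y
  have "smooth_path (\<lambda>r _. 2) (\<lambda>r _. 0)" by (rule smooth_path_scalar) auto
  note path2 = smooth_path_mult[OF this smooth_path_Gam[OF P]]
  have path: "smooth_path u u'"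
    using smooth_path_add[OF smooth_path_mult[OF P P] smooth_path_mult[OF Epath path2]]
    by (simp add: u_def[abs_def] u'_def[abs_def])
  have W: "sup_le ?W (2 * B + \<bar>2 * K\<bar>)"
    using sup_le_add[OF sup_le_scale[OF \<rho>, of 2], of "\<lambda>_. - 2 * K" "\<bar>2 * K\<bar>"] by (simp add: sup_le_def)
  have "u t x \<le> op_exp (H ?W) t (u 0) x"
  proof (rule subsolution_le_exp[OF W path t])
    fix r y assume r: "0 \<le> (r :: real)"
    let ?G = "Gam w m (?P r) (?P r)"
    obtain C' where "sup_le (?P r) C'" using smooth_pathD(2)[OF P, of "\<bar>r\<bar>"] by blast
    then have "\<rho> y * ?G y \<le> Gam2 w m (?P r) (?P r) y"
      using curv unfolding curvature_ge_def by blast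
    then have "0 \<le> E r * (4 * (Gam2 w m (?P r) (?P r) y - \<rho> y * ?G y))"
      using E(3)[OF r] by simp
    moreover have "0 \<le> (2 * K - 2 * \<rho> y) * (?P r y * ?P r y)"
      using K[of y] by (intro mult_nonneg_nonneg[OF _ zero_le_square]) simp
    moreover have "H ?W (u r) y - u' r y
        = E r * (4 * (Gam2 w m (?P r) (?P r) y - \<rho> y * ?G y)) + (2 * K - 2 * \<rho> y) * (?P r y * ?P r y)"
    proof -
      have lin: "Lap w m (\<lambda>y. a y + E r * (2 * b y)) y = Lap w m a y + E r * (2 * Lap w m b y)" for a b
        using locally_finite_op_lincomb[OF locally_finite_schroedinger, of "\<lambda>_. 0" 1 a "E r * 2" b y]
        unfolding schroedinger_zero by (simp add: mult.assoc)
      have sq: "Lap w m (\<lambda>y. ?P r y * ?P r y) y = 2 * ?G y + 2 * (?P r y * Lap w m (?P r) y)"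
        by (simp add: Gam_def field_simps)
      have G2: "Lap w m ?G y = 2 * Gam2 w m (?P r) (?P r) y + 2 * Gam w m (?P r) (Lap w m (?P r)) y"
        by (simp add: Gam2_def field_simps)
      show ?thesis
        unfolding schroedinger_def u_def[abs_def] u'_def lin sq G2 by (simp add: algebra_simps)
    qed
    ultimately show "u' r y \<le> H ?W (u r) y" by linarith
  qed
  moreover have "u 0 = (\<lambda>y. (f y)\<^sup>2)" by (simp add: u_def[abs_def] E(2) power2_eq_square)
  moreover have "op_exp (H ?W) t (\<lambda>y. (f y)\<^sup>2) x
      = exp (2 * K * t) * op_exp (H (\<lambda>y. 2 * \<rho> y)) t (\<lambda>y. (f y)\<^sup>2) x"
    using exp_shift_potential[OF sup_le_scale[OF \<rho>] sup_le_mult[OF f f]] by (simp add: power2_eq_square)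
  ultimately show ?thesis by (simp add: u_def power2_eq_square)
qed

end

theorem theorem4p1:
  fixes w :: "'v::countable \<Rightarrow> 'v \<Rightarrow> real" and m \<rho> :: "'v \<Rightarrow> real" and n :: ereal
  assumes "mwg w m"
    and "bdd_above (range (Deg w m))"
    and "0 < n"
    and "CD w m \<rho> n"
  shows "\<forall>f :: 'v \<Rightarrow> real. \<forall>t :: real. bounded (range f) \<and> 0 < t \<longrightarrow>
    (\<forall>x. ereal (Gam w m (heat w m t f) (heat w m t f) x)
          \<le> semigroup_pot w m (\<lambda>y. 2 * \<rho> y) t (Gam w m f f) x) \<and>
    (\<forall>x. ereal (2 * t * Gam w m (heat w m t f) (heat w m t f) x)
          \<le> semigroup_pot w m (\<lambda>y. - 2 * neg_part (\<rho> y)) t (\<lambda>y. (f y)\<^sup>2) x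
            - ereal ((heat w m t f x)\<^sup>2)) \<and>
    (\<forall>K :: real. K \<noteq> 0 \<and> (\<forall>y. \<rho> y \<le> K) \<longrightarrow>
      (\<forall>x. ereal (1 / (2 * K) * (exp (2 * K * t) - 1) * Gam w m (heat w m t f) (heat w m t f) x)
          \<le> ereal (exp (2 * K * t)) * semigroup_pot w m (\<lambda>y. 2 * \<rho> y) t (\<lambda>y. (f y)\<^sup>2) x
            - ereal ((heat w m t f x)\<^sup>2)))"
proof (intro allI impI, elim conjE)
  fix f :: "'v \<Rightarrow> real" and t :: real
  assume "bounded (range f)" and "0 < t"
  then have t: "0 \<le> t" by simp
  obtain C where f: "sup_le f C"
    using \<open>bounded (range f)\<close> by (auto simp: bounded_iff sup_le_def)
  obtain D0 where D0: "\<And>x. Deg w m x \<le> D0"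
    using assms(2) by (auto simp: bdd_above_def)
  define D where "D = max D0 1"
  interpret bounded_graph w m D
    by standard (use assms(1) D0 in \<open>auto simp: D_def le_max_iff_disj\<close>)
  have curv: "curvature_ge \<rho>" by (rule CD_imp_curvature_ge[OF assms(4,3)])
  obtain R where R: "\<And>x. \<rho> x \<le> R" using curvature_bounded_above[OF curv] by blast
  have heat: "heat w m t f = op_exp (Lap w m) t f" by (rule heat_eq[OF f t])
  have trunc: "sup_le (\<lambda>x. max (\<sigma> x) (- c)) (max \<bar>R\<bar> \<bar>c\<bar>)" if "\<And>x. \<sigma> x \<le> \<rho> x" for \<sigma> c
    unfolding sup_le_def
  proof
    fix x
    show "\<bar>max (\<sigma> x) (- c)\<bar> \<le> max \<bar>R\<bar> \<bar>c\<bar>" using that[of x] R[of x] by linarith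
  qed
  have Gf: "sup_le (Gam w m f f) (D * (2 * C * (2 * C)))" by (rule Gam_sup_le[OF f f])
  have f2: "sup_le (\<lambda>y. (f y)\<^sup>2) (C * C)"
    using sup_le_mult[OF f f] by (simp add: power2_eq_square)
  have f2_nonneg: "0 \<le> (f y)\<^sup>2" for y by simp
  have "ereal (Gam w m (heat w m t f) (heat w m t f) x)
      \<le> semigroup_pot w m (\<lambda>y. 2 * \<rho> y) t (Gam w m f f) x" for x
  proof -
    define \<sigma> where "\<sigma> y = max (\<rho> y) (- D)" for y
    have \<sigma>: "sup_le \<sigma> (max \<bar>R\<bar> \<bar>D\<bar>)" "curvature_ge \<sigma>"
      unfolding \<sigma>_def[abs_def] by (rule trunc curvature_ge_truncate[OF curv]; simp)+
    have "ereal (Gam w m (heat w m t f) (heat w m t f) x)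
        \<le> ereal (op_exp (H (\<lambda>y. 2 * \<sigma> y)) t (Gam w m f f) x)"
      unfolding heat using gradient_estimate[OF \<sigma>(2,1) f t] by simp
    also have "\<dots> \<le> semigroup_pot w m (\<lambda>y. 2 * \<rho> y) t (Gam w m f f) x"
      by (rule exp_le_semigroup_pot[OF sup_le_scale[OF \<sigma>(1)] _ Gf Gam_nonneg t]) (simp add: \<sigma>_def)
    finally show ?thesis .
  qed
  moreover have "ereal (2 * t * Gam w m (heat w m t f) (heat w m t f) x)
      \<le> semigroup_pot w m (\<lambda>y. - 2 * neg_part (\<rho> y)) t (\<lambda>y. (f y)\<^sup>2) x
        - ereal ((heat w m t f x)\<^sup>2)" for x
  proof -
    define \<sigma> where "\<sigma> y = max (min 0 (\<rho> y)) (- D)" for y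
    have \<sigma>: "sup_le \<sigma> (max \<bar>R\<bar> \<bar>D\<bar>)" "curvature_ge \<sigma>"
      unfolding \<sigma>_def[abs_def] by (rule trunc curvature_ge_truncate[OF curv]; simp)+
    have "2 * t * Gam w m (heat w m t f) (heat w m t f) x
        \<le> exp (2 * 0 * t) * op_exp (H (\<lambda>y. 2 * \<sigma> y)) t (\<lambda>y. (f y)\<^sup>2) x - (heat w m t f x)\<^sup>2"
      unfolding heat
      by (rule reverse_poincare[OF \<sigma>(2,1), of 0 "\<lambda>r. r", OF _ _ _ _ f t])
         (use D_ge_1 in \<open>auto simp: \<sigma>_def\<close>)
    then have "ereal (2 * t * Gam w m (heat w m t f) (heat w m t f) x)
        \<le> ereal (op_exp (H (\<lambda>y. 2 * \<sigma> y)) t (\<lambda>y. (f y)\<^sup>2) x) - ereal ((heat w m t f x)\<^sup>2)" by simp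
    also have "\<dots> \<le> semigroup_pot w m (\<lambda>y. - 2 * neg_part (\<rho> y)) t (\<lambda>y. (f y)\<^sup>2) x
        - ereal ((heat w m t f x)\<^sup>2)"
      by (intro ereal_minus_mono exp_le_semigroup_pot[OF sup_le_scale[OF \<sigma>(1)] _ f2 f2_nonneg t])
         (auto simp: \<sigma>_def neg_part_def)
    finally show ?thesis .
  qed
  moreover have "ereal (1 / (2 * K) * (exp (2 * K * t) - 1) * Gam w m (heat w m t f) (heat w m t f) x)
      \<le> ereal (exp (2 * K * t)) * semigroup_pot w m (\<lambda>y. 2 * \<rho> y) t (\<lambda>y. (f y)\<^sup>2) x
        - ereal ((heat w m t f x)\<^sup>2)" if K: "K \<noteq> 0" "\<And>y. \<rho> y \<le> K" for K x
  proof -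
    \<comment> \<open>The cutoff \<open>- c\<close> must not exceed \<open>K\<close>, so that the truncated curvature stays below \<open>K\<close>.\<close>
    define c where "c = max D (- K)"
    define \<sigma> where "\<sigma> y = max (\<rho> y) (- c)" for y
    have \<sigma>: "sup_le \<sigma> (max \<bar>R\<bar> \<bar>c\<bar>)" "curvature_ge \<sigma>"
      unfolding \<sigma>_def[abs_def] by (rule trunc curvature_ge_truncate[OF curv]; simp add: c_def)+
    have \<sigma>K: "\<sigma> y \<le> K" for y using K(2)[of y] by (simp add: \<sigma>_def c_def)
    define E where "E r = 1 / (2 * K) * (exp (2 * K * r) - 1)" for r
    have E: "(E has_real_derivative 1 + 2 * K * E r) (at r)" for r
      unfolding E_def[abs_def] using K(1) by (auto intro!: derivative_eq_intros simp: field_simps)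
    have E_nonneg: "0 \<le> E r" if "0 \<le> r" for r
    proof (cases "0 < K")
      case True
      then show ?thesis using that by (simp add: E_def)
    next
      case False
      then have "exp (2 * K * r) \<le> 1" using that by (simp add: mult_nonpos_nonneg)
      then show ?thesis using False K(1) by (simp add: E_def divide_nonpos_neg zero_le_divide_iff)
    qed
    let ?G = "Gam w m (heat w m t f) (heat w m t f) x"
    have "2 * E t * ?G \<le> exp (2 * K * t) * op_exp (H (\<lambda>y. 2 * \<sigma> y)) t (\<lambda>y. (f y)\<^sup>2) x
        - (heat w m t f x)\<^sup>2"
      unfolding heat
      by (rule reverse_poincare[OF \<sigma>(2,1) \<sigma>K E _ E_nonneg f t]) (simp_all add: E_def)
    \<comment> \<open>Dropping one of the two copies of \<open>E t * ?G\<close> costs nothing, as it is nonnegative.\<close>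
    moreover have "0 \<le> E t * ?G" using E_nonneg[OF t] Gam_nonneg by simp
    ultimately have "ereal (E t * ?G) \<le> ereal (exp (2 * K * t))
        * ereal (op_exp (H (\<lambda>y. 2 * \<sigma> y)) t (\<lambda>y. (f y)\<^sup>2) x) - ereal ((heat w m t f x)\<^sup>2)" by simp
    also have "\<dots> \<le> ereal (exp (2 * K * t)) * semigroup_pot w m (\<lambda>y. 2 * \<rho> y) t (\<lambda>y. (f y)\<^sup>2) x
        - ereal ((heat w m t f x)\<^sup>2)"
      by (intro ereal_minus_mono ereal_mult_left_mono
            exp_le_semigroup_pot[OF sup_le_scale[OF \<sigma>(1)] _ f2 f2_nonneg t])
         (auto simp: \<sigma>_def)
    finally show ?thesis unfolding E_def .
  qed
  ultimately show "(\<forall>x. ereal (Gam w m (heat w m t f) (heat w m t f) x)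
          \<le> semigroup_pot w m (\<lambda>y. 2 * \<rho> y) t (Gam w m f f) x) \<and>
    (\<forall>x. ereal (2 * t * Gam w m (heat w m t f) (heat w m t f) x)
          \<le> semigroup_pot w m (\<lambda>y. - 2 * neg_part (\<rho> y)) t (\<lambda>y. (f y)\<^sup>2) x
            - ereal ((heat w m t f x)\<^sup>2)) \<and>
    (\<forall>K :: real. K \<noteq> 0 \<and> (\<forall>y. \<rho> y \<le> K) \<longrightarrow>
      (\<forall>x. ereal (1 / (2 * K) * (exp (2 * K * t) - 1) * Gam w m (heat w m t f) (heat w m t f) x)
          \<le> ereal (exp (2 * K * t)) * semigroup_pot w m (\<lambda>y. 2 * \<rho> y) t (\<lambda>y. (f y)\<^sup>2) x
            - ereal ((heat w m t f x)\<^sup>2)))"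
    by blast
qed

end
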